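(* Let $u\in H^{2}((t_{0},t_{m}),\mathbb{R}^{n})$ be a minimizer of $\mathcal{E}(u)=E(u)+E_{C}(u)$ over all of $H^{2}((t_{0},t_{m}),\mathbb{R}^{n})$, and write $u(t)=\sum_{i=1}^{n}\omega_{i}(t)\phi_{i}$. Then: (i) for every $i$ and every $k=1,\dots,m$, the restriction of $\omega_i$ to the open interval $(t_{k-1},t_k)$ is smooth and satisfies the wiggly spline equation $$\omega_i''''+2(\lambda_i-2\delta_i^2)\,\omega_i''+\lambda_i(\lambda_i\omega_i+g_i)=0,$$ i.e. $u$ is of the form $u=\sum_i\omega_i\phi_i$ with each $\omega_i$ a wiggly spline with nodes $t_0,\dots,t_m$; (ii) $u$ is continuously differentiable on $[t_0,t_m]$, in particular once differentiable at every node $t_k$; (iii) $u$ is twice differentiable at every interior node $t_k$ ($1\le k\le m-1$) at which no velocity is prescribed, i.e. at which the one-sided second derivatives of $u$ from the left and from the right coincide.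
   Context: Let $M\in\mathbb{R}^{n\times n}$ be symmetric positive definite (mass matrix), $K\in\mathbb{R}^{n\times n}$ symmetric positive semidefinite (stiffness matrix), $\alpha,\beta\ge 0$ constants, $D=\alpha M+\beta K$ (Rayleigh damping), and $g\in\mathbb{R}^n$ a constant vector. Let $t_0<t_1<\dots<t_m$ be nodes. For $u\in H^{2}((t_{0},t_{m}),\mathbb{R}^{n})$ define $$E(u)=\frac12\int_{t_0}^{t_m}\big\|M\ddot u+D\dot u+Ku+g\big\|_{M^{-1}}^2\,dt,\qquad \|x\|_{M^{-1}}^2=x^TM^{-1}x,$$ and, for given matrices $A_k,B_k$ (with $n$ columns, possibly with zero rows) and vectors $a_k,b_k$ of matching sizes, and positive constants $c_A,c_B$, $$E_C(u)=\frac12\sum_{k=0}^{m}\Big(c_A\|A_ku(t_k)-a_k\|^2+c_B\|B_k\dot u(t_k)-b_k\|^2\Big).$$ "No velocity is prescribed at $t_k$" means $B_k$ has no rows (the velocity term at $t_k$ is absent). Let $\phi_1,\dots,\phi_n$ be an $M$-orthonormal basis of generalized eigenvectors, $K\phi_i=\lambda_iM\phi_i$, set $\delta_i=(\alpha+\beta\lambda_i)/2$, and define $g_i$ by $g=\sum_i g_iM\phi_i$ (i.e. $g_i=\phi_i^Tg$). Elements of $H^2$ are identified with their continuously differentiable representatives. *)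

theory Defs
  imports "HOL-Analysis.Analysis"
begin

text \<open>Sobolev space H^2((a,b), R^n), identified with C^1 representatives:
  u is differentiable on [a,b] with derivative u1, and u1 is the indefinite
  integral of a square-integrable function u2 (the weak second derivative).\<close>
definition H2 :: "real \<Rightarrow> real \<Rightarrow> (real \<Rightarrow> real ^ 'n) \<Rightarrow> bool" where
  "H2 a b u \<longleftrightarrow> (\<exists>u1 u2.
      (\<forall>t\<in>{a..b}. (u has_vector_derivative u1 t) (at t within {a..b})) \<and>
      u2 absolutely_integrable_on {a..b} \<and>
      (\<lambda>t. (norm (u2 t))\<^sup>2) integrable_on {a..b} \<and>
      (\<forall>t\<in>{a..b}. u1 t = u1 a + integral {a..t} u2))"

definition vel :: "real \<Rightarrow> real \<Rightarrow> (real \<Rightarrow> real ^ 'n) \<Rightarrow> real \<Rightarrow> real ^ 'n" where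
  "vel a b u t = vector_derivative u (at t within {a..b})"

definition acc :: "real \<Rightarrow> real \<Rightarrow> (real \<Rightarrow> real ^ 'n) \<Rightarrow> real \<Rightarrow> real ^ 'n" where
  "acc a b u t = vector_derivative (vel a b u) (at t within {a..b})"

definition sym_posdef :: "real ^ 'n ^ 'n \<Rightarrow> bool" where
  "sym_posdef M \<longleftrightarrow> transpose M = M \<and> (\<forall>x. x \<noteq> 0 \<longrightarrow> x \<bullet> (M *v x) > 0)"

definition sym_possemidef :: "real ^ 'n ^ 'n \<Rightarrow> bool" where
  "sym_possemidef K \<longleftrightarrow> transpose K = K \<and> (\<forall>x. x \<bullet> (K *v x) \<ge> 0)"

definition energyE ::
  "real ^ 'n ^ 'n \<Rightarrow> real ^ 'n ^ 'n \<Rightarrow> real ^ 'n ^ 'n \<Rightarrow> real ^ 'n \<Rightarrow> real \<Rightarrow> real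
   \<Rightarrow> (real \<Rightarrow> real ^ 'n) \<Rightarrow> real" where
  "energyE M D K g a b u = 1/2 * integral {a..b} (\<lambda>t.
      let r = M *v acc a b u t + D *v vel a b u t + K *v u t + g
      in r \<bullet> (matrix_inv M *v r))"

text \<open>Squared Euclidean norm of (A x - a) where the matrix A is given by its list of rows
  (possibly empty).\<close>
definition resid2 :: "(real ^ 'n) list \<Rightarrow> real list \<Rightarrow> real ^ 'n \<Rightarrow> real" where
  "resid2 A a x = (\<Sum>j<length A. (A ! j \<bullet> x - a ! j)\<^sup>2)"

definition energyC ::
  "real \<Rightarrow> real \<Rightarrow> (nat \<Rightarrow> (real ^ 'n) list) \<Rightarrow> (nat \<Rightarrow> real list) \<Rightarrow>
   (nat \<Rightarrow> (real ^ 'n) list) \<Rightarrow> (nat \<Rightarrow> real list) \<Rightarrow> (nat \<Rightarrow> real) \<Rightarrow> nat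
   \<Rightarrow> (real \<Rightarrow> real ^ 'n) \<Rightarrow> real" where
  "energyC cA cB A a B b t m u = 1/2 * (\<Sum>k\<le>m.
      cA * resid2 (A k) (a k) (u (t k)) + cB * resid2 (B k) (b k) (vel (t 0) (t m) u (t k)))"

definition smooth_on :: "(real \<Rightarrow> real) \<Rightarrow> real set \<Rightarrow> bool" where
  "smooth_on f S \<longleftrightarrow> (\<forall>j. \<forall>x\<in>S. ((deriv ^^ j) f) differentiable (at x))"

end

theory Submission
  imports Defs
begin

text \<open>
  Varying a minimizer \<open>u\<close> in the direction \<open>h \<phi>\<^sub>i\<close>, with \<open>h\<close> vanishing at all nodes and \<open>h'\<close> vanishing
  at the nodes with a prescribed velocity, leaves the constraint energy unchanged. Hence the residual mode
  \<open>R = \<omega>'' + 2 \<delta> \<omega>' + \<lambda> \<omega> + g\<^sub>i\<close> satisfies \<open>\<integral> R (h'' + 2 \<delta> h' + \<lambda> h) = 0\<close>. Two integrations by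
  parts turn this into the orthogonality of \<open>R - 2 \<delta> \<integral>R + \<lambda> \<integral>\<integral>R\<close> to every square-integrable \<open>h''\<close> that
  satisfies finitely many moment conditions, so that this function is, almost everywhere, a combination of
  the moment weights. On an interval between consecutive nodes the weights are affine, so \<open>R\<close> solves
  \<open>R'' - 2 \<delta> R' + \<lambda> R = 0\<close> and the fourth-order equation follows. Across a node \<open>q\<close> without
  prescribed velocity the only further weight is the continuous function \<open>max 0 (q - x)\<close>, so \<open>R\<close>, and with
  it \<open>\<omega>''\<close>, has a continuous representative near \<open>q\<close>.
\<close>

section \<open>Lebesgue differentiation\<close>

text \<open>The intervals with a bad difference quotient form a Vitali cover of the exceptional set, and
  Henstock's lemma bounds the total length of each finite disjoint subfamily.\<close>
lemma negligible_bad_difference_quotient: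
  fixes f :: "real \<Rightarrow> 'a::euclidean_space"
  assumes f: "f integrable_on {a..b}" and e: "e > 0"
  shows "negligible {x \<in> {a<..<b}. \<forall>d>0. \<exists>y\<in>{a<..<b}. y \<noteq> x \<and> \<bar>y - x\<bar> < d \<and>
           e * \<bar>y - x\<bar> < norm (\<bar>y - x\<bar> *\<^sub>R f x - integral {min x y..max x y} f)}"
    (is "negligible ?S")
  unfolding negligible_outer_le
proof (intro allI impI)
  fix \<epsilon> :: real assume \<epsilon>: "\<epsilon> > 0"
  \<comment> \<open>Henstock's lemma is used with tolerance \<open>e * \<epsilon>\<close>, so that
    cancelling the factor \<open>e\<close> at the end leaves a total length below
    \<open>\<epsilon>\<close>.\<close>
  have "f integrable_on cbox a b" "e * \<epsilon> > 0" using f e \<epsilon> by auto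
  then obtain \<gamma> where \<gamma>: "gauge \<gamma>"
    and hen: "\<And>p. \<lbrakk>p tagged_partial_division_of cbox a b; \<gamma> fine p\<rbrakk> \<Longrightarrow>
        (\<Sum>(x,k)\<in>p. norm (measure lborel k *\<^sub>R f x - integral k f)) < e * \<epsilon>"
    by (rule Henstock_lemma) (rule that, assumption, simp)
  define J where "J = (\<lambda>z::real \<times> real. {min (fst z) (snd z)..max (fst z) (snd z)})"
  \<comment> \<open>A pair codes a bad interval: the first component is its tag and one endpoint,
    the second the other endpoint. The inclusion in \<open>\<gamma> (fst z)\<close> makes every
    subfamily fine.\<close>
  define K where "K = {z. fst z \<in> {a<..<b} \<and> snd z \<in> {a<..<b} \<and> snd z \<noteq> fst z \<and> J z \<subseteq> \<gamma> (fst z) \<and>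
        e * \<bar>snd z - fst z\<bar> < norm (\<bar>snd z - fst z\<bar> *\<^sub>R f (fst z) - integral (J z) f)}"
  \<comment> \<open>Midpoint and half-length rewrite the intervals as closed balls, the form in
    which the Vitali covering theorem applies.\<close>
  define c where "c = (\<lambda>z::real \<times> real. (fst z + snd z) / 2)"
  define r where "r = (\<lambda>z::real \<times> real. \<bar>snd z - fst z\<bar> / 2)"
  have cb: "cball (c z) (r z) = J z" for z
    unfolding cball_eq_atLeastAtMost c_def r_def J_def by (auto simp: min_def max_def field_simps)
  have fine: "\<exists>z. z \<in> K \<and> x \<in> cball (c z) (r z) \<and> r z < d" if x: "x \<in> ?S" and d: "0 < d" for x d
  proof -
    have "open (\<gamma> x)" "x \<in> \<gamma> x" using \<gamma> by (auto simp: gauge_def)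
    then obtain d' where d': "d' > 0" "ball x d' \<subseteq> \<gamma> x"
      using open_contains_ball by blast
    have "min d d' > 0" using d d'(1) by simp
    with x obtain y where y: "y \<in> {a<..<b}" "y \<noteq> x" "\<bar>y - x\<bar> < min d d'"
       "e * \<bar>y - x\<bar> < norm (\<bar>y - x\<bar> *\<^sub>R f x - integral {min x y..max x y} f)"
      by blast
    have "J (x, y) \<subseteq> ball x d'"
      using y(3) by (auto simp: J_def dist_real_def)
    then have "(x, y) \<in> K" using x y d' by (auto simp: K_def J_def)
    moreover have "x \<in> J (x, y)" by (auto simp: J_def)
    moreover have "r (x, y) < d" using y(3) by (auto simp: r_def)
    ultimately show ?thesis unfolding cb[symmetric] by blast
  qed
  have rpos: "0 < r z" if "z \<in> K" for z using that by (auto simp: K_def r_def)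
  obtain C where C: "countable C" "C \<subseteq> K"
     "pairwise (\<lambda>i j. disjnt (J i) (J j)) C" "negligible (?S - (\<Union>i \<in> C. J i))"
    using rpos fine unfolding cb[symmetric] by (rule Vitali_covering_theorem_cballs)
  have lm: "J i \<in> lmeasurable" for i by (simp add: J_def)
  have bound: "measure lebesgue (\<Union>i\<in>F. J i) \<le> \<epsilon>" if F: "F \<subseteq> C" "finite F" for F
  proof -
    let ?p = "(\<lambda>z. (fst z, J z)) ` F"
    have disj: "J z \<inter> J w = {}" if "z \<in> F" "w \<in> F" "z \<noteq> w" for z w
      using C(3) F(1) that by (auto simp: pairwise_def disjnt_def)
    have ne: "fst z \<in> J z" for z by (auto simp: J_def)
    have inj: "inj_on (\<lambda>z. (fst z, J z)) F"
    proof (rule inj_onI)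
      fix z w assume "z \<in> F" "w \<in> F" "(fst z, J z) = (fst w, J w)"
      then show "z = w" using disj[of z w] ne[of z] by auto
    qed
    have "?p tagged_partial_division_of cbox a b"
      unfolding tagged_partial_division_of_def
    proof (intro conjI allI impI)
      fix x k assume "(x, k) \<in> ?p"
      then obtain z where z: "z \<in> F" "x = fst z" "k = J z" by auto
      then have "z \<in> K" using F C by auto
      then show "x \<in> k" "k \<subseteq> cbox a b"
        using z ne by (auto simp: K_def J_def)
      show "\<exists>a b. k = cbox a b" unfolding z(3) J_def by (metis box_real(2))
    next
      fix x1 k1 x2 k2 assume "(x1, k1) \<in> ?p \<and> (x2, k2) \<in> ?p \<and> (x1, k1) \<noteq> (x2, k2)"
      then obtain z w where "z \<in> F" "w \<in> F" "k1 = J z" "k2 = J w" "z \<noteq> w" by auto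
      then show "interior k1 \<inter> interior k2 = {}"
        using disj[of z w] interior_subset[of k1] interior_subset[of k2] by blast
    qed (use F in auto)
    moreover have "\<gamma> fine ?p"
      using F C unfolding fine_def K_def by auto
    ultimately have "(\<Sum>(x,k)\<in>?p. norm (measure lborel k *\<^sub>R f x - integral k f)) < e * \<epsilon>"
      by (rule hen)
    then have *: "(\<Sum>z\<in>F. norm (measure lborel (J z) *\<^sub>R f (fst z) - integral (J z) f)) < e * \<epsilon>"
      by (simp add: sum.reindex[OF inj] o_def)
    have con: "measure lborel (J z) = \<bar>snd z - fst z\<bar>" for z by (auto simp: J_def)
    \<comment> \<open>Badness says exactly that each interval contributes at least \<open>e\<close>
      times its length to the Henstock sum.\<close>
    have "e * (\<Sum>z\<in>F. measure lborel (J z)) \<le> (\<Sum>z\<in>F. norm (measure lborel (J z) *\<^sub>R f (fst z) - integral (J z) f))"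
      unfolding sum_distrib_left
      by (rule sum_mono) (use F C in \<open>auto simp: con K_def\<close>)
    then have "(\<Sum>z\<in>F. measure lborel (J z)) < \<epsilon>" using * e
      by (meson le_less_trans mult_less_cancel_left_pos)
    moreover have "measure lebesgue (\<Union>i\<in>F. J i) \<le> (\<Sum>z\<in>F. measure lebesgue (J z))"
      using F by (intro measure_UNION_le) (use lm fmeasurableD in blast)+
    ultimately show ?thesis by (simp add: J_def)
  qed
  show "\<exists>T. ?S \<subseteq> T \<and> T \<in> lmeasurable \<and> measure lebesgue T \<le> \<epsilon>"
  proof (intro exI conjI)
    show "?S \<subseteq> (\<Union>i\<in>C. J i) \<union> (?S - (\<Union>i\<in>C. J i))" by blast
    have 1: "(\<Union>i\<in>C. J i) \<in> lmeasurable" "measure lebesgue (\<Union>i\<in>C. J i) \<le> \<epsilon>"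
      using fmeasurable_UN_bound[OF C(1) lm bound] measure_UN_bound[OF C(1) lm bound] by auto
    have 2: "?S - (\<Union>i\<in>C. J i) \<in> null_sets lebesgue" using C(4) by (simp add: negligible_iff_null_sets)
    show "(\<Union>i\<in>C. J i) \<union> (?S - (\<Union>i\<in>C. J i)) \<in> lmeasurable"
      by (rule fmeasurable.Un[OF 1(1) negligible_imp_measurable[OF C(4)]])
    show "measure lebesgue ((\<Union>i\<in>C. J i) \<union> (?S - (\<Union>i\<in>C. J i))) \<le> \<epsilon>"
      using 1 2 by (subst measure_Un_null_set) auto
  qed
qed

text \<open>Lebesgue's differentiation theorem: the exceptional set is the union of the bad sets for
  the tolerances \<open>1 / (n + 1)\<close>. Outside it every tolerance is met near
  \<open>x\<close>.\<close>

lemma integral_has_vector_derivative_ae: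
  fixes f :: "real \<Rightarrow> 'a::euclidean_space"
  assumes f: "f integrable_on {a..b}"
  obtains N where "negligible N"
    "\<And>x. x \<in> {a<..<b} - N \<Longrightarrow> ((\<lambda>t. integral {a..t} f) has_vector_derivative f x) (at x)"
proof
  define S where "S = (\<lambda>e. {x \<in> {a<..<b}. \<forall>d>0. \<exists>y\<in>{a<..<b}. y \<noteq> x \<and> \<bar>y - x\<bar> < d \<and>
           e * \<bar>y - x\<bar> < norm (\<bar>y - x\<bar> *\<^sub>R f x - integral {min x y..max x y} f)})"
  show "negligible (\<Union>n. S (1 / real (Suc n)))"
    unfolding S_def by (intro negligible_Union_nat negligible_bad_difference_quotient f) auto
  fix x assume x: "x \<in> {a<..<b} - (\<Union>n. S (1 / real (Suc n)))"
  let ?F = "\<lambda>t. integral {a..t} f"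
  show "(?F has_vector_derivative f x) (at x)"
    unfolding has_vector_derivative_def has_derivative_within_alt
  proof (intro conjI allI impI)
    fix e :: real assume e: "e > 0"
    then obtain n where n: "1 / real (Suc n) < e" using nat_approx_posE by blast
    have "x \<notin> S (1 / real (Suc n))" "x \<in> {a<..<b}" using x by blast+
    then have "\<exists>d>0. \<forall>y\<in>{a<..<b}. y \<noteq> x \<longrightarrow> \<bar>y - x\<bar> < d \<longrightarrow>
        norm (\<bar>y - x\<bar> *\<^sub>R f x - integral {min x y..max x y} f) \<le> 1 / real (Suc n) * \<bar>y - x\<bar>"
      unfolding S_def mem_Collect_eq by (meson not_less)
    then obtain d where d: "d > 0" "\<And>y. y \<in> {a<..<b} \<Longrightarrow> y \<noteq> x \<Longrightarrow> \<bar>y - x\<bar> < d \<Longrightarrow>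
        norm (\<bar>y - x\<bar> *\<^sub>R f x - integral {min x y..max x y} f) \<le> 1 / real (Suc n) * \<bar>y - x\<bar>"
      by blast
    show "\<exists>d>0. \<forall>y\<in>UNIV. norm (y - x) < d \<longrightarrow> norm (?F y - ?F x - (y - x) *\<^sub>R f x) \<le> e * norm (y - x)"
    proof (intro exI[of _ "min d (min (x - a) (b - x))"] conjI ballI impI)
      show "0 < min d (min (x - a) (b - x))" using x d by auto
      fix y assume y: "norm (y - x) < min d (min (x - a) (b - x))"
      then have yab: "y \<in> {a<..<b}" by auto
      show "norm (?F y - ?F x - (y - x) *\<^sub>R f x) \<le> e * norm (y - x)"
      proof (cases y x rule: linorder_cases)
        case less
        have "?F y + integral {y..x} f = ?F x"
          using less x yab by (intro Henstock_Kurzweil_Integration.integral_combine integrable_subinterval_real[OF f]) auto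
        then have "?F y - ?F x - (y - x) *\<^sub>R f x = \<bar>y - x\<bar> *\<^sub>R f x - integral {min x y..max x y} f"
          using less by (simp add: algebra_simps)
        also have "norm \<dots> \<le> 1 / real (Suc n) * \<bar>y - x\<bar>" using d(2)[OF yab] y less by auto
        also have "\<dots> \<le> e * \<bar>y - x\<bar>" using n by (intro mult_right_mono) auto
        finally show ?thesis by simp
      next
        case greater
        have "?F x + integral {x..y} f = ?F y"
          using greater x yab by (intro Henstock_Kurzweil_Integration.integral_combine integrable_subinterval_real[OF f]) auto
        then have "?F y - ?F x - (y - x) *\<^sub>R f x = - (\<bar>y - x\<bar> *\<^sub>R f x - integral {min x y..max x y} f)"
          using greater by (simp add: algebra_simps)
        also have "norm \<dots> \<le> 1 / real (Suc n) * \<bar>y - x\<bar>" 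
          unfolding norm_minus_cancel using d(2)[OF yab] y greater by auto
        also have "\<dots> \<le> e * \<bar>y - x\<bar>" using n by (intro mult_right_mono) auto
        finally show ?thesis by simp
      qed simp
    qed
  qed (rule bounded_linear_scaleR_left)
qed

section \<open>Integration by parts for indefinite integrals\<close>

text \<open>Cut \<open>{p..r}\<close> into equally long pieces shorter than \<open>d\<close> and add
  up the local bounds; the increments of \<open>V\<close> telescope, so the bound does not depend on
  the number of pieces.\<close>

lemma bound_by_fine_partition:
  fixes H V :: "real \<Rightarrow> real"
  assumes "p \<le> r" "d > 0"
    and step: "\<And>s t. \<lbrakk>p \<le> s; s \<le> t; t \<le> r; t - s < d\<rbrakk> \<Longrightarrow> \<bar>H t - H s\<bar> \<le> e * (V t - V s)"
  shows "\<bar>H r - H p\<bar> \<le> e * (V r - V p)"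
proof -
  obtain n :: nat where n: "(r - p) / d < real n" using reals_Archimedean2 by blast
  moreover have "0 \<le> (r - p) / d" using assms by simp
  ultimately have n0: "real n > 0" by linarith
  define x where "x i = p + real i * ((r - p) / n)" for i :: nat
  have w: "0 \<le> (r - p) / n" "(r - p) / n < d"
    using assms n n0 by (auto simp: field_simps)
  have le: "p \<le> x i" for i unfolding x_def using w by (simp add: mult_nonneg_nonneg del: times_divide_eq_right)
  have stp: "x (Suc i) = x i + (r - p) / n" for i
    unfolding x_def by (simp only: of_nat_Suc distrib_right mult_1 add.assoc add.commute)
  have top: "x i \<le> r" if "i \<le> n" for i
  proof -
    have "real i * ((r - p) / n) \<le> real n * ((r - p) / n)" using w that by (intro mult_right_mono) auto
    then show ?thesis using n0 by (simp add: x_def)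
  qed
  have "\<bar>H (x i) - H p\<bar> \<le> e * (V (x i) - V p)" if "i \<le> n" for i
    using that
  proof (induction i)
    case (Suc i)
    have "\<bar>H (x (Suc i)) - H (x i)\<bar> \<le> e * (V (x (Suc i)) - V (x i))"
      using le[of i] top[OF Suc.prems] w stp[of i] by (intro step) auto
    then show ?case using Suc by (simp add: algebra_simps)
  qed (simp add: x_def)
  from this[of n] show ?thesis using n0 by (simp add: x_def)
qed

lemma absolutely_integrable_continuous_mult:
  fixes f g :: "real \<Rightarrow> real"
  assumes "continuous_on {p..r} f" "g absolutely_integrable_on {p..r}"
  shows "(\<lambda>x. f x * g x) absolutely_integrable_on {p..r}"
  using assms
  by (intro absolutely_integrable_bounded_measurable_product_real)
     (auto intro: continuous_imp_measurable_on_sets_lebesgue compact_imp_bounded compact_continuous_image)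

text \<open>\<open>F\<close> and \<open>G\<close> are primitives of merely integrable functions.
  Both vanish at \<open>p\<close>, so only the boundary term at \<open>r\<close> remains.\<close>

lemma integral_by_parts_indefinite:
  fixes f g :: "real \<Rightarrow> real"
  assumes pr: "p \<le> r"
    and f: "f absolutely_integrable_on {p..r}" and g: "g absolutely_integrable_on {p..r}"
  defines "F \<equiv> \<lambda>t. integral {p..t} f" and "G \<equiv> \<lambda>t. integral {p..t} g"
  shows "integral {p..r} (\<lambda>x. F x * g x) = F r * G r - integral {p..r} (\<lambda>x. G x * f x)"
proof -
  have fi: "f integrable_on {p..r}" and gi: "g integrable_on {p..r}"
    using f g by (auto simp: absolutely_integrable_on_def)
  have cF: "continuous_on {p..r} F" and cG: "continuous_on {p..r} G"
    unfolding F_def G_def using fi gi by (auto intro: indefinite_integral_continuous_1)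
  have Gf: "(\<lambda>x. G x * f x) integrable_on {p..r}" and Fg: "(\<lambda>x. F x * g x) integrable_on {p..r}"
    using absolutely_integrable_continuous_mult[OF cG f] absolutely_integrable_continuous_mult[OF cF g]
    by (auto simp: absolutely_integrable_on_def)
  have ab: "(\<lambda>x. \<bar>f x\<bar> + \<bar>g x\<bar>) integrable_on {p..r}"
    using f g by (auto simp: absolutely_integrable_on_def intro: integrable_add)
  \<comment> \<open>\<open>V\<close> is the monotone measure of size against which the increments of
    \<open>H\<close>, the defect in the product formula, are compared.\<close>
  define V where "V t = integral {p..t} (\<lambda>x. \<bar>f x\<bar> + \<bar>g x\<bar>)" for t
  define H where "H t = F t * G t - integral {p..t} (\<lambda>x. G x * f x + F x * g x)" for t
  have sub: "h integrable_on {s..t}" if "h integrable_on {p..r}" "p \<le> s" "t \<le> r" for h :: "real \<Rightarrow> real" and s t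
    using that by (intro integrable_subinterval_real[OF that(1)]) auto
  have comb: "integral {p..t} h - integral {p..s} h = integral {s..t} h"
    if "h integrable_on {p..r}" "p \<le> s" "s \<le> t" "t \<le> r" for h :: "real \<Rightarrow> real" and s t
    using Henstock_Kurzweil_Integration.integral_combine[of p s t h] sub[of h p t] that by simp
  \<comment> \<open>On short intervals the increments of \<^term>\<open>H\<close> are small compared with those of \<^term>\<open>V\<close>, so
    \<^term>\<open>H\<close> is constant. Unlike an argument by derivatives this needs no continuity of the integrands.\<close>
  have key: "\<bar>H r - H p\<bar> \<le> e * (V r - V p)" if e: "e > 0" for e
  proof -
    have "uniformly_continuous_on {p..r} F" "uniformly_continuous_on {p..r} G"
      using cF cG by (auto intro: compact_uniformly_continuous)
    then obtain d1 d2 where d: "d1 > 0" "d2 > 0"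
      and d1: "\<forall>x\<in>{p..r}. \<forall>y\<in>{p..r}. dist y x < d1 \<longrightarrow> dist (F y) (F x) < e"
      and d2: "\<forall>x\<in>{p..r}. \<forall>y\<in>{p..r}. dist y x < d2 \<longrightarrow> dist (G y) (G x) < e"
      unfolding uniformly_continuous_on_def using e by metis
    show ?thesis
    proof (rule bound_by_fine_partition[OF pr, of "min d1 d2"])
      fix s t assume st: "p \<le> s" "s \<le> t" "t \<le> r" "t - s < min d1 d2"
      have i1: "f integrable_on {s..t}" "g integrable_on {s..t}" "(\<lambda>x. G x * f x) integrable_on {s..t}"
        "(\<lambda>x. F x * g x) integrable_on {s..t}" "(\<lambda>x. \<bar>f x\<bar> + \<bar>g x\<bar>) integrable_on {s..t}"
        using sub fi gi Gf Fg ab st by auto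
      \<comment> \<open>Splitting the increment of the product freezes \<open>G\<close> at the right
        end and \<open>F\<close> at the left end; uniform continuity then bounds the differences
        \<open>G t - G x\<close> and \<open>F s - F x\<close> by \<open>e\<close>.\<close>
      have "H t - H s = (F t - F s) * G t + F s * (G t - G s)
          - (integral {p..t} (\<lambda>x. G x * f x + F x * g x) - integral {p..s} (\<lambda>x. G x * f x + F x * g x))"
        by (simp add: H_def algebra_simps)
      also have "\<dots> = integral {s..t} f * G t + F s * integral {s..t} g - integral {s..t} (\<lambda>x. G x * f x + F x * g x)"
      proof -
        have "F t - F s = integral {s..t} f" "G t - G s = integral {s..t} g"
          using comb[OF fi, of s t] comb[OF gi, of s t] st by (simp_all add: F_def G_def)
        then show ?thesis using comb[OF integrable_add[OF Gf Fg], of s t] st by simp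
      qed
      also have "\<dots> = integral {s..t} (\<lambda>x. (f x * G t + F s * g x) - (G x * f x + F x * g x))"
      proof -
        have "(\<lambda>x. f x * G t) integrable_on {s..t}" "(\<lambda>x. F s * g x) integrable_on {s..t}"
          using i1 by (auto intro: integrable_on_mult_left integrable_on_mult_right)
        then show ?thesis using i1
          by (subst integral_diff) (auto simp: integral_add intro!: integrable_add)
      qed
      finally have eq: "H t - H s = \<dots>" .
      have "norm (H t - H s) \<le> integral {s..t} (\<lambda>x. e * (\<bar>f x\<bar> + \<bar>g x\<bar>))"
        unfolding eq
      proof (rule integral_norm_bound_integral)
        fix x assume x: "x \<in> {s..t}"
        have "\<bar>F s - F x\<bar> < e" "\<bar>G t - G x\<bar> < e"
          using d1[rule_format, of x s] d2[rule_format, of x t] st x by (auto simp: dist_real_def)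
        then have "\<bar>F s - F x\<bar> * \<bar>g x\<bar> \<le> e * \<bar>g x\<bar>" "\<bar>G t - G x\<bar> * \<bar>f x\<bar> \<le> e * \<bar>f x\<bar>"
          by (auto intro: mult_right_mono)
        moreover have "f x * G t + F s * g x - (G x * f x + F x * g x) = (G t - G x) * f x + (F s - F x) * g x"
          by (simp add: algebra_simps)
        ultimately show "norm (f x * G t + F s * g x - (G x * f x + F x * g x)) \<le> e * (\<bar>f x\<bar> + \<bar>g x\<bar>)"
          unfolding real_norm_def distrib_left abs_mult[symmetric]
          by (smt (verit) abs_mult abs_triangle_ineq)
      qed (use i1 in \<open>auto intro!: integrable_add integrable_diff integrable_on_mult_right integrable_on_mult_left\<close>)
      also have "\<dots> = e * (V t - V s)"
        using st by (simp add: V_def comb[OF ab])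
      finally show "\<bar>H t - H s\<bar> \<le> e * (V t - V s)" by simp
    qed (use d in auto)
  qed
  have V0: "V r - V p \<ge> 0" unfolding V_def using ab by (auto intro!: integral_nonneg)
  have "\<bar>H r - H p\<bar> \<le> 0"
  proof (rule field_le_epsilon)
    fix e :: real assume e: "e > 0"
    \<comment> \<open>The summand 1 keeps the denominator positive when the increment of
      \<open>V\<close> is zero.\<close>
    have "e / (V r - V p + 1) * (V r - V p) \<le> e" using V0 e by (simp add: field_simps)
    moreover have "e / (V r - V p + 1) > 0" using V0 e by simp
    ultimately show "\<bar>H r - H p\<bar> \<le> 0 + e" using key[of "e / (V r - V p + 1)"] by linarith
  qed
  then have "H r = 0" by (simp add: H_def F_def G_def)
  then show ?thesis using Gf Fg by (simp add: H_def integral_add algebra_simps)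
qed

section \<open>Square-integrable functions and the weak adjoint equation\<close>

text \<open>Measurability is a separate clause because integrability of the square does not control
  the sign of \<open>f\<close>. Functions are not identified up to null sets.\<close>

definition L2_on :: "(real \<Rightarrow> real) \<Rightarrow> real set \<Rightarrow> bool" where
  "L2_on f S \<longleftrightarrow> f \<in> borel_measurable (lebesgue_on S) \<and> (\<lambda>x. (f x)\<^sup>2) integrable_on S"

lemma L2_on_mult:
  assumes f: "L2_on f {p..r}" and g: "L2_on g {p..r}"
  shows "(\<lambda>x. f x * g x) absolutely_integrable_on {p..r}"
proof (rule measurable_bounded_by_integrable_imp_absolutely_integrable)
  show "(\<lambda>x. f x * g x) \<in> borel_measurable (lebesgue_on {p..r})"
    using f g by (auto simp: L2_on_def)
  show "(\<lambda>x. (f x)\<^sup>2 + (g x)\<^sup>2) integrable_on {p..r}"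
    using f g by (auto simp: L2_on_def intro: integrable_add)
  show "norm (f x * g x) \<le> (f x)\<^sup>2 + (g x)\<^sup>2" for x
  proof -
    have "0 \<le> (\<bar>f x\<bar> - \<bar>g x\<bar>)\<^sup>2" by simp
    then have "2 * (\<bar>f x\<bar> * \<bar>g x\<bar>) \<le> (f x)\<^sup>2 + (g x)\<^sup>2" by (simp add: power2_diff)
    moreover have "0 \<le> \<bar>f x\<bar> * \<bar>g x\<bar>" by simp
    ultimately show ?thesis unfolding real_norm_def abs_mult by linarith
  qed
qed auto

lemma L2_on_continuous:
  assumes "continuous_on {p..r} f"
  shows "L2_on f {p..r}"
  using assms unfolding L2_on_def
  by (auto intro!: continuous_imp_measurable_on_sets_lebesgue integrable_continuous_interval continuous_intros)

lemma L2_on_imp_absolutely_integrable: "L2_on f {p..r} \<Longrightarrow> f absolutely_integrable_on {p..r}"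
  using L2_on_mult[OF _ L2_on_continuous[of p r "\<lambda>_. 1"]] by simp

lemma L2_on_cmult: "L2_on f {p..r} \<Longrightarrow> L2_on (\<lambda>x. c * f x) {p..r}"
  by (auto simp: L2_on_def power_mult_distrib intro: integrable_on_mult_right)

lemma L2_on_add:
  assumes f: "L2_on f {p..r}" and g: "L2_on g {p..r}"
  shows "L2_on (\<lambda>x. f x + g x) {p..r}"
proof -
  have "(\<lambda>x. f x * g x) integrable_on {p..r}"
    using L2_on_mult[OF f g] by (simp add: absolutely_integrable_on_def)
  then have "(\<lambda>x. ((f x)\<^sup>2 + (g x)\<^sup>2) + 2 * (f x * g x)) integrable_on {p..r}"
    using f g unfolding L2_on_def by (intro integrable_add integrable_on_mult_right) auto
  then show ?thesis using f g by (auto simp: L2_on_def power2_sum mult.assoc)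
qed

lemma L2_on_diff: "L2_on f {p..r} \<Longrightarrow> L2_on g {p..r} \<Longrightarrow> L2_on (\<lambda>x. f x - g x) {p..r}"
  using L2_on_add[of f p r "\<lambda>x. (-1) * g x"] L2_on_cmult[of g p r "-1"] by simp

lemma L2_on_sum: "(\<And>i. i \<in> I \<Longrightarrow> L2_on (f i) {p..r}) \<Longrightarrow> L2_on (\<lambda>x. \<Sum>i\<in>I. f i x) {p..r}"
  by (induction I rule: infinite_finite_induct) (auto intro: L2_on_add L2_on_continuous)

lemma L2_on_subinterval:
  assumes "L2_on f {a..b}" "{p..r} \<subseteq> {a..b}"
  shows "L2_on f {p..r}"
proof -
  have "f \<in> borel_measurable (lebesgue_on {p..r})"
    using absolutely_integrable_on_subinterval[OF L2_on_imp_absolutely_integrable[OF assms(1)] assms(2)]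
    by (simp add: absolutely_integrable_measurable)
  then show ?thesis
    using assms integrable_subinterval_real[of "\<lambda>x. (f x)\<^sup>2"] by (auto simp: L2_on_def)
qed

lemma L2_on_zero_ae:
  assumes f: "L2_on f {p..r}" and 0: "integral {p..r} (\<lambda>x. f x * f x) = 0"
  shows "negligible {x \<in> {p..r}. f x \<noteq> 0}"
proof -
  have int: "integrable (lebesgue_on {p..r}) (\<lambda>x. f x * f x)"
    using L2_on_mult[OF f f] by (intro absolutely_integrable_imp_integrable) auto
  then have "integral\<^sup>L (lebesgue_on {p..r}) (\<lambda>x. f x * f x) = 0"
    using 0 by (simp add: lebesgue_integral_eq_integral)
  then have "AE x in lebesgue_on {p..r}. f x * f x = 0"
    using integral_nonneg_eq_0_iff_AE[OF int] by auto
  then have "AE x in lebesgue. x \<in> {p..r} \<longrightarrow> f x = 0"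
    by (simp add: AE_restrict_space_iff)
  then have "{x. \<not> (x \<in> {p..r} \<longrightarrow> f x = 0)} \<in> null_sets lebesgue"
    by (simp add: AE_iff_null_sets completion.AE_iff_null_sets) 
  then show ?thesis by (simp add: negligible_iff_null_sets)
qed

text \<open>The degenerate case of Gram-Schmidt: a representative of norm zero vanishes almost
  everywhere, hence pairs to zero with any \<open>g\<close>.\<close>

lemma L2_on_inner_zero:
  assumes f: "L2_on f {p..r}" and 0: "integral {p..r} (\<lambda>x. f x * f x) = 0"
  shows "integral {p..r} (\<lambda>x. g x * f x) = 0"
  using integral_spike[OF L2_on_zero_ae[OF assms], of "{p..r}" "\<lambda>x. g x * f x" "\<lambda>_. 0"] by auto

section \<open>Orthogonal projection onto finitely many square-integrable functions\<close>

text \<open>Gram-Schmidt, one function at a time. Linear dependence is allowed, which matters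
  because the moment weights used later become dependent when \<open>q = p\<close>.\<close>

lemma L2_projection:
  assumes "finite I" "\<And>i. i \<in> I \<Longrightarrow> L2_on (e i) {p..r}" "L2_on F {p..r}"
  shows "\<exists>c. \<forall>j\<in>I. integral {p..r} (\<lambda>x. (F x - (\<Sum>i\<in>I. c i * e i x)) * e j x) = 0"
  using assms
proof (induction I arbitrary: F rule: finite_induct)
  case (insert k I)
  let ?L = "\<lambda>f. L2_on f {p..r}"
  let ?ip = "\<lambda>f g. integral {p..r} (\<lambda>x. f x * g x)"
  have int: "(\<lambda>x. f x * g x) integrable_on {p..r}" if "?L f" "?L g" for f g
    using L2_on_mult[OF that] by (simp add: absolutely_integrable_on_def)
  have lin: "?ip (\<lambda>x. f x - s * g x) h = ?ip f h - s * ?ip g h" if "?L f" "?L g" "?L h" for f g h s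
    using int[OF that(1,3)] int[OF that(2,3)]
    by (simp add: left_diff_distrib mult.assoc integral_diff integrable_on_mult_right)
  have lin2: "?ip h (\<lambda>x. f x + g x) = ?ip h f + ?ip h g" if "?L f" "?L g" "?L h" for f g h
    using int[OF that(3,1)] int[OF that(3,2)] by (simp add: distrib_left integral_add)
  have lin3: "?ip h (\<lambda>x. \<Sum>i\<in>I. d i * e i x) = (\<Sum>i\<in>I. d i * ?ip h (e i))" if "?L h" for h d
  proof -
    have "?ip h (\<lambda>x. \<Sum>i\<in>I. d i * e i x) = integral {p..r} (\<lambda>x. \<Sum>i\<in>I. d i * (h x * e i x))"
      by (simp add: sum_distrib_left mult.left_commute)
    also have "\<dots> = (\<Sum>i\<in>I. integral {p..r} (\<lambda>x. d i * (h x * e i x)))"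
      using insert that int by (intro integral_sum integrable_on_mult_right) auto
    finally show ?thesis by simp
  qed
  \<comment> \<open>The induction hypothesis is used twice: for \<open>F\<close> and for the new
    function \<open>e k\<close>, whose component \<open>y\<close> orthogonal to the old ones carries
    the remaining correction.\<close>
  obtain c where c: "\<forall>j\<in>I. ?ip (\<lambda>x. F x - (\<Sum>i\<in>I. c i * e i x)) (e j) = 0"
    using insert.IH[OF insert.prems(1) insert.prems(2)] by blast
  obtain d where d: "\<forall>j\<in>I. ?ip (\<lambda>x. e k x - (\<Sum>i\<in>I. d i * e i x)) (e j) = 0"
    using insert.IH[OF insert.prems(1) insert.prems(1)[of k]] by blast
  define G where "G x = F x - (\<Sum>i\<in>I. c i * e i x)" for x
  define y where "y x = e k x - (\<Sum>i\<in>I. d i * e i x)" for x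
  have ek: "?L (e k)" and ei: "\<And>i. i \<in> I \<Longrightarrow> ?L (e i)" and Fk: "?L F" using insert by auto
  have LG: "?L G" and Ly: "?L y"
    unfolding G_def[abs_def] y_def[abs_def] using ek ei Fk by (intro L2_on_diff L2_on_sum L2_on_cmult; simp)+
  have Ls: "?L (\<lambda>x. \<Sum>i\<in>I. d i * e i x)" using ei by (intro L2_on_sum L2_on_cmult)
  have c: "?ip G (e j) = 0" and d: "?ip y (e j) = 0" if "j \<in> I" for j
    using c d that by (auto simp: G_def y_def)
  \<comment> \<open>Against anything orthogonal to the old functions, \<open>e k\<close> and
    \<open>y\<close> are interchangeable, so it suffices to make \<open>h\<close> orthogonal to
    \<open>y\<close>.\<close>
  have ek_eq: "?ip h (e k) = ?ip h y" if "?L h" "\<And>j. j \<in> I \<Longrightarrow> ?ip h (e j) = 0" for h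
  proof -
    have "?ip h (e k) = ?ip h (\<lambda>x. y x + (\<Sum>i\<in>I. d i * e i x))" by (simp add: y_def)
    also have "\<dots> = ?ip h y" using lin2[OF Ly Ls that(1)] lin3[OF that(1), of d] that(2) by simp
    finally show ?thesis .
  qed
  \<comment> \<open>If \<open>y\<close> has norm zero, orthogonality to \<open>y\<close> is
    automatic and the coefficient 0 serves.\<close>
  define s where "s = (if ?ip y y = 0 then 0 else ?ip G y / ?ip y y)"
  define h where "h x = G x - s * y x" for x
  have Lh: "?L h" unfolding h_def[abs_def] using LG Ly by (intro L2_on_diff L2_on_cmult)
  have hI: "?ip h (e j) = 0" if "j \<in> I" for j
    unfolding h_def using lin[OF LG Ly ei[OF that]] c d that by simp
  have hy: "?ip h y = 0"
  proof (cases "?ip y y = 0")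
    case True then show ?thesis by (rule L2_on_inner_zero[OF Ly])
  next
    case False
    then show ?thesis unfolding h_def using lin[OF LG Ly Ly, of s] by (simp add: s_def)
  qed
  define c' where "c' i = (if i = k then s else c i - s * d i)" for i
  have "F x - (\<Sum>i\<in>insert k I. c' i * e i x) = h x" for x
  proof -
    have "(\<Sum>i\<in>I. c' i * e i x) = (\<Sum>i\<in>I. c i * e i x) - s * (\<Sum>i\<in>I. d i * e i x)"
      unfolding sum_distrib_left sum_subtractf[symmetric]
      using insert(2) by (intro sum.cong) (auto simp: c'_def algebra_simps)
    then show ?thesis using insert(1,2) by (simp add: h_def G_def y_def c'_def algebra_simps)
  qed
  then show ?case using hI hy ek_eq[OF Lh hI] by (intro exI[of _ c']) auto
qed auto

section \<open>Moment weights and the weak adjoint equation\<close>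

lemma integral_max_weight:
  fixes f :: "real \<Rightarrow> real"
  assumes "p \<le> q" "q \<le> r" and f: "f absolutely_integrable_on {p..r}"
  shows "integral {p..r} (\<lambda>x. max 0 (q - x) * f x) = integral {p..q} (\<lambda>x. (q - x) * f x)"
proof -
  have "continuous_on {p..r} (\<lambda>x. max 0 (q - x))" by (intro continuous_intros)
  then have "(\<lambda>x. max 0 (q - x) * f x) integrable_on {p..r}"
    using absolutely_integrable_continuous_mult[OF _ f] by (auto simp: absolutely_integrable_on_def)
  then have "integral {p..r} (\<lambda>x. max 0 (q - x) * f x) =
      integral {p..q} (\<lambda>x. max 0 (q - x) * f x) + integral {q..r} (\<lambda>x. max 0 (q - x) * f x)"
    using assms by (simp add: Henstock_Kurzweil_Integration.integral_combine)
  also have "integral {p..q} (\<lambda>x. max 0 (q - x) * f x) = integral {p..q} (\<lambda>x. (q - x) * f x)"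
    by (intro integral_cong) auto
  also have "integral {q..r} (\<lambda>x. max 0 (q - x) * f x) = integral {q..r} (\<lambda>x. 0)"
    by (intro integral_cong) auto
  finally show ?thesis by simp
qed

text \<open>Cauchy's formula for repeated integration, from integration by parts against the
  constant 1. It turns the vanishing of a second primitive at a point into a moment
  condition.\<close>

lemma double_integral_eq:
  fixes f :: "real \<Rightarrow> real"
  assumes "p \<le> q" and f: "f absolutely_integrable_on {p..q}"
  shows "integral {p..q} (\<lambda>t. integral {p..t} f) = integral {p..q} (\<lambda>x. (q - x) * f x)"
proof -
  have 1: "(\<lambda>x. 1::real) absolutely_integrable_on {p..q}"
    by (intro absolutely_integrable_continuous_real continuous_intros)
  have fi: "f integrable_on {p..q}" using f by (simp add: absolutely_integrable_on_def)
  have xf: "(\<lambda>x. (x - p) * f x) integrable_on {p..q}"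
  proof -
    have "continuous_on {p..q} (\<lambda>x. x - p)" by (intro continuous_intros)
    from absolutely_integrable_continuous_mult[OF this f] show ?thesis
      by (simp add: absolutely_integrable_on_def)
  qed
  have "integral {p..q} (\<lambda>t. integral {p..t} f)
      = integral {p..q} f * (q - p) - integral {p..q} (\<lambda>x. integral {p..x} (\<lambda>_. 1) * f x)"
    using integral_by_parts_indefinite[OF assms(1) f 1] assms(1) by simp
  also have "integral {p..q} (\<lambda>x. integral {p..x} (\<lambda>_. 1) * f x) = integral {p..q} (\<lambda>x. (x - p) * f x)"
    by (intro integral_cong) auto
  also have "integral {p..q} f * (q - p) - \<dots> = integral {p..q} (\<lambda>x. (q - p) * f x - (x - p) * f x)"
    using fi xf by (subst integral_diff) (auto intro: integrable_on_mult_right)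
  finally show ?thesis by (simp add: algebra_simps)
qed

text \<open>The weight \<^term>\<open>max 0 (q - x)\<close> encodes the constraint that the test function with second
  derivative \<^term>\<open>h\<close> vanish at \<^term>\<open>q\<close>; it is identically zero on \<^term>\<open>{p..r}\<close> if
  \<^term>\<open>q = p\<close>.\<close>
lemma weak_adjoint_equation:
  fixes R :: "real \<Rightarrow> real"
  assumes pqr: "p \<le> q" "q \<le> r" and R: "L2_on R {p..r}"
    and van: "\<And>h. \<lbrakk>L2_on h {p..r}; integral {p..r} h = 0; integral {p..r} (\<lambda>x. (r - x) * h x) = 0;
        integral {p..r} (\<lambda>x. max 0 (q - x) * h x) = 0\<rbrakk> \<Longrightarrow>
        integral {p..r} (\<lambda>x. R x * (h x + 2 * \<delta> * integral {p..x} h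
          + l * integral {p..x} (\<lambda>y. integral {p..y} h))) = 0"
  obtains c0 c1 c2 N where "negligible N"
    "\<And>x. x \<in> {p..r} - N \<Longrightarrow> R x = c0 + c1 * (r - x) + c2 * max 0 (q - x)
       + 2 * \<delta> * integral {p..x} R - l * integral {p..x} (\<lambda>y. integral {p..y} R)"
proof -
  have pr: "p \<le> r" using pqr by simp
  define R1 where "R1 x = integral {p..x} R" for x
  define R2 where "R2 x = integral {p..x} R1" for x
  \<comment> \<open>\<open>F\<close> is what multiplies \<open>h\<close> once its primitives have
    been moved onto \<open>R\<close>: one integration by parts changes the sign, two restore
    it.\<close>
  define F where "F x = R x - 2 * \<delta> * R1 x + l * R2 x" for x
  \<comment> \<open>Orthogonality to these three weights means, in order, that the first primitive
    of \<open>h\<close> vanishes at \<open>r\<close>, the second at \<open>r\<close>, and the second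
    at \<open>q\<close>.\<close>
  define e :: "nat \<Rightarrow> real \<Rightarrow> real" where
    "e i x = (if i = 0 then 1 else if i = 1 then r - x else max 0 (q - x))" for i x
  let ?ip = "\<lambda>f g. integral {p..r} (\<lambda>x. f x * g x :: real)"
  have Ra: "R absolutely_integrable_on {p..r}" using R by (rule L2_on_imp_absolutely_integrable)
  have cR1: "continuous_on {p..r} R1" unfolding R1_def[abs_def]
    using Ra by (auto simp: absolutely_integrable_on_def intro: indefinite_integral_continuous_1)
  have R1a: "R1 absolutely_integrable_on {p..r}" using cR1 by (rule absolutely_integrable_continuous_real)
  have cR2: "continuous_on {p..r} R2" unfolding R2_def[abs_def]
    using R1a by (auto simp: absolutely_integrable_on_def intro: indefinite_integral_continuous_1)
  have LF: "L2_on F {p..r}" unfolding F_def[abs_def]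
    by (intro L2_on_add L2_on_diff L2_on_cmult R L2_on_continuous[OF cR1] L2_on_continuous[OF cR2])
  have Le: "L2_on (e i) {p..r}" for i unfolding e_def[abs_def]
    by (cases "i = 0"; cases "i = 1") (auto intro!: L2_on_continuous continuous_intros)
  obtain c where c: "\<forall>j\<in>{..<3}. ?ip (\<lambda>x. F x - (\<Sum>i<3. c i * e i x)) (e j) = 0"
    using L2_projection[of "{..<3::nat}" e, OF _ Le LF] by auto
  \<comment> \<open>The test function is the part of \<open>F\<close> orthogonal to the weights. It
    is admissible by construction, and testing with it will force its own norm to be zero.\<close>
  define h where "h x = F x - (\<Sum>i<3. c i * e i x)" for x
  have Lh: "L2_on h {p..r}" unfolding h_def[abs_def]
    using LF Le by (intro L2_on_diff L2_on_sum L2_on_cmult)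
  have int: "(\<lambda>x. f x * g x) integrable_on {p..r}" if "L2_on f {p..r}" "L2_on g {p..r}" for f g
    using L2_on_mult[OF that] by (simp add: absolutely_integrable_on_def)
  have he: "?ip h (e j) = 0" if "j < 3" for j using c that by (simp add: h_def)
  have h0: "integral {p..r} h = 0" "integral {p..r} (\<lambda>x. (r - x) * h x) = 0"
      "integral {p..r} (\<lambda>x. max 0 (q - x) * h x) = 0"
    using he[of 0] he[of 1] he[of 2] by (simp_all add: e_def mult.commute)
  define h1 where "h1 x = integral {p..x} h" for x
  define h2 where "h2 x = integral {p..x} h1" for x
  have ha: "h absolutely_integrable_on {p..r}" using Lh by (rule L2_on_imp_absolutely_integrable)
  have ch1: "continuous_on {p..r} h1" unfolding h1_def[abs_def]
    using ha by (auto simp: absolutely_integrable_on_def intro: indefinite_integral_continuous_1)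
  have h1a: "h1 absolutely_integrable_on {p..r}" using ch1 by (rule absolutely_integrable_continuous_real)
  have ch2: "continuous_on {p..r} h2" unfolding h2_def[abs_def]
    using h1a by (auto simp: absolutely_integrable_on_def intro: indefinite_integral_continuous_1)
  have h1r: "h1 r = 0" using h0 by (simp add: h1_def)
  have h2r: "h2 r = 0" using double_integral_eq[OF pr ha] h0 by (simp add: h2_def h1_def[abs_def])
  note ibp = integral_by_parts_indefinite[OF pr]
  \<comment> \<open>The boundary terms at \<open>r\<close> vanish by \<open>h1r\<close> and
    \<open>h2r\<close>.\<close>
  have A: "?ip h1 R = - ?ip R1 h"
    using ibp[OF ha Ra] h1r by (simp add: h1_def[symmetric] R1_def[symmetric])
  have B: "?ip h1 R1 = - ?ip R2 h"
    using ibp[OF ha R1a] h1r by (simp add: h1_def[symmetric] R2_def[symmetric])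
  have C: "?ip h2 R = - ?ip h1 R1"
    using ibp[OF h1a Ra] h2r by (simp add: h2_def[symmetric] R1_def[symmetric] mult.commute)
  have "integral {p..r} (\<lambda>x. R x * (h x + 2 * \<delta> * h1 x + l * h2 x)) = 0"
    using van[OF Lh h0] by (simp add: h1_def[abs_def] h2_def)
  also have "(\<lambda>x. R x * (h x + 2 * \<delta> * h1 x + l * h2 x)) =
      (\<lambda>x. R x * h x + 2 * \<delta> * (h1 x * R x) + l * (h2 x * R x))"
    by (simp add: algebra_simps)
  also have "integral {p..r} \<dots> = ?ip R h + 2 * \<delta> * ?ip h1 R + l * ?ip h2 R"
    using int[OF R Lh] int[OF L2_on_continuous[OF ch1] R] int[OF L2_on_continuous[OF ch2] R]
    by (simp add: integral_add integrable_add integrable_on_mult_right)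
  also have "\<dots> = ?ip R h - 2 * \<delta> * ?ip R1 h + l * ?ip R2 h" by (simp add: A B C)
  also have "\<dots> = integral {p..r} (\<lambda>x. R x * h x - 2 * \<delta> * (R1 x * h x) + l * (R2 x * h x))"
    using int[OF R Lh] int[OF L2_on_continuous[OF cR1] Lh] int[OF L2_on_continuous[OF cR2] Lh]
    by (simp add: integral_add integral_diff integrable_add integrable_diff integrable_on_mult_right)
  also have "\<dots> = ?ip F h" by (simp add: F_def algebra_simps)
  finally have Fh: "?ip F h = 0" by simp
  \<comment> \<open>Since \<open>h\<close> is orthogonal to the weights, its squared norm equals its
    pairing with \<open>F\<close>, which is zero.\<close>
  have "h x * h x = F x * h x - (\<Sum>i<3. c i * (h x * e i x))" for x
  proof -
    have "h x * h x = (F x - (\<Sum>i<3. c i * e i x)) * h x" by (subst h_def) (rule refl)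
    also have "\<dots> = F x * h x - (\<Sum>i<3. c i * (h x * e i x))"
      unfolding left_diff_distrib sum_distrib_right by (simp add: mult_ac)
    finally show ?thesis .
  qed
  then have "?ip h h = integral {p..r} (\<lambda>x. F x * h x - (\<Sum>i<3. c i * (h x * e i x)))"
    by simp
  also have "\<dots> = ?ip F h - (\<Sum>i<3. c i * ?ip h (e i))"
    using int[OF LF Lh] int[OF Lh Le]
    by (simp add: integral_diff integral_sum integrable_sum integrable_on_mult_right)
  also have "\<dots> = 0" using Fh he by simp
  finally have "negligible {x \<in> {p..r}. h x \<noteq> 0}" by (rule L2_on_zero_ae[OF Lh])
  moreover have "R x = c 0 + c 1 * (r - x) + c 2 * max 0 (q - x)
       + 2 * \<delta> * integral {p..x} R - l * integral {p..x} (\<lambda>y. integral {p..y} R)"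
    if "x \<in> {p..r} - {x \<in> {p..r}. h x \<noteq> 0}" for x
  proof -
    have "h x = 0" using that by blast
    then have "R x - 2 * \<delta> * R1 x + l * R2 x = c 0 + c 1 * (r - x) + c 2 * max 0 (q - x)"
      by (simp add: h_def F_def e_def eval_nat_numeral)
    then show ?thesis unfolding R2_def R1_def[abs_def] by linarith
  qed
  ultimately show ?thesis by (rule that)
qed

section \<open>First variation of the energy\<close>

text \<open>Exposes the witnesses hidden in \<open>H2\<close>, so that the weak derivatives can be
  named across lemmas.\<close>

definition H2_derivs :: "real \<Rightarrow> real \<Rightarrow> (real \<Rightarrow> real ^ 'n) \<Rightarrow> (real \<Rightarrow> real ^ 'n) \<Rightarrow> (real \<Rightarrow> real ^ 'n) \<Rightarrow> bool" where
  "H2_derivs a b u u1 u2 \<longleftrightarrow>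
      (\<forall>t\<in>{a..b}. (u has_vector_derivative u1 t) (at t within {a..b})) \<and>
      u2 absolutely_integrable_on {a..b} \<and>
      (\<lambda>t. (norm (u2 t))\<^sup>2) integrable_on {a..b} \<and>
      (\<forall>t\<in>{a..b}. u1 t = u1 a + integral {a..t} u2)"

lemma H2_iff: "H2 a b u \<longleftrightarrow> (\<exists>u1 u2. H2_derivs a b u u1 u2)"
  by (simp add: H2_def H2_derivs_def)

lemma H2_derivs_ftc:
  "H2_derivs a b u u1 u2 \<Longrightarrow> t \<in> {a..b} \<Longrightarrow> u1 t = u1 a + integral {a..t} u2"
  unfolding H2_derivs_def by blast

lemma H2_derivs_integrable:
  assumes "H2_derivs a b u u1 u2"
  shows "u2 absolutely_integrable_on {a..b}" "u2 integrable_on {a..b}"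
  using assms unfolding H2_derivs_def absolutely_integrable_on_def by blast+

lemma H2_derivs_continuous:
  assumes "H2_derivs a b u u1 u2"
  shows "continuous_on {a..b} u" "continuous_on {a..b} u1"
proof -
  show "continuous_on {a..b} u"
    using assms unfolding H2_derivs_def continuous_on_eq_continuous_within
    by (meson has_vector_derivative_continuous)
  have "u2 integrable_on {a..b}" using assms by (rule H2_derivs_integrable)
  then have "continuous_on {a..b} (\<lambda>t. u1 a + integral {a..t} u2)"
    by (intro continuous_intros indefinite_integral_continuous_1)
  moreover have "\<And>t. t \<in> {a..b} \<Longrightarrow> u1 a + integral {a..t} u2 = u1 t"
    using H2_derivs_ftc[OF assms] by metis
  ultimately show "continuous_on {a..b} u1" by (rule continuous_on_eq)
qed

lemma H2_derivs_vel:
  assumes "H2_derivs a b u u1 u2" "a < b" "t \<in> {a..b}"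
  shows "vel a b u t = u1 t"
  unfolding vel_def using assms
  unfolding H2_derivs_def by (intro vector_derivative_within_closed_interval) blast+

text \<open>\<^const>\<open>acc\<close> is a pointwise derivative with an arbitrary value where none exists, hence the null set.\<close>
lemma H2_derivs_acc_ae:
  assumes u: "H2_derivs a b u u1 u2" and ab: "a < b"
  obtains N where "negligible N" "\<And>t. t \<in> {a..b} - N \<Longrightarrow> acc a b u t = u2 t"
proof -
  have "u2 integrable_on {a..b}" using u by (rule H2_derivs_integrable)
  then obtain N where N: "negligible N"
    "\<And>x. x \<in> {a<..<b} - N \<Longrightarrow> ((\<lambda>t. integral {a..t} u2) has_vector_derivative u2 x) (at x)"
    using integral_has_vector_derivative_ae by blast
  show ?thesis
  proof
    show "negligible (N \<union> {a, b})" using N by simp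
    fix t assume t: "t \<in> {a..b} - (N \<union> {a, b})"
    then have "((\<lambda>t. integral {a..t} u2) has_vector_derivative u2 t) (at t within {a..b})"
      using N(2)[of t] by (auto intro: has_vector_derivative_at_within)
    then have "((\<lambda>t. u1 a + integral {a..t} u2) has_vector_derivative 0 + u2 t) (at t within {a..b})"
      by (intro has_vector_derivative_add has_vector_derivative_const)
    then have "((\<lambda>t. u1 a + integral {a..t} u2) has_vector_derivative u2 t) (at t within {a..b})"
      by simp
    then have "(vel a b u has_vector_derivative u2 t) (at t within {a..b})"
    proof (rule has_vector_derivative_transform[rotated 2])
      show "t \<in> {a..b}" using t by simp
      fix x assume "x \<in> {a..b}"
      then show "vel a b u x = u1 a + integral {a..x} u2"
        using H2_derivs_vel[OF u ab] H2_derivs_ftc[OF u] by metis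
    qed
    then show "acc a b u t = u2 t"
      unfolding acc_def using ab t by (intro vector_derivative_within_closed_interval) auto
  qed
qed

text \<open>Pointwise and weak second derivatives differ only on a null set, so the energy may be
  computed with \<open>u2\<close>, which behaves linearly under variations.\<close>

lemma energyE_eq:
  assumes u: "H2_derivs a b u u1 u2" and ab: "a < b"
  shows "energyE M D K g a b u = 1/2 * integral {a..b} (\<lambda>t.
      (M *v u2 t + D *v u1 t + K *v u t + g) \<bullet>
        (matrix_inv M *v (M *v u2 t + D *v u1 t + K *v u t + g)))"
proof -
  obtain N where N: "negligible N" "\<And>t. t \<in> {a..b} - N \<Longrightarrow> acc a b u t = u2 t"
    using H2_derivs_acc_ae[OF assms] by blast
  show ?thesis
    unfolding energyE_def Let_def
    by (intro arg_cong[where f = "\<lambda>x. 1/2 * x"] integral_spike[OF N(1)])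
       (use N(2) H2_derivs_vel[OF assms] in auto)
qed

lemma L2_on_inner:
  fixes f :: "real \<Rightarrow> 'a::euclidean_space"
  assumes f: "f absolutely_integrable_on {a..b}" "(\<lambda>t. (norm (f t))\<^sup>2) integrable_on {a..b}"
  shows "L2_on (\<lambda>t. c \<bullet> f t) {a..b}"
proof -
  have "f \<in> borel_measurable (lebesgue_on {a..b})"
    using f by (simp add: absolutely_integrable_measurable)
  then have m: "(\<lambda>t. c \<bullet> f t) \<in> borel_measurable (lebesgue_on {a..b})" by simp
  moreover have "(\<lambda>t. (c \<bullet> f t)\<^sup>2) integrable_on {a..b}"
  proof (rule measurable_bounded_by_integrable_imp_integrable)
    show "(\<lambda>t. (c \<bullet> f t)\<^sup>2) \<in> borel_measurable (lebesgue_on {a..b})" using m by simp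
    show "(\<lambda>t. (norm c)\<^sup>2 * (norm (f t))\<^sup>2) integrable_on {a..b}"
      using f by (intro integrable_on_mult_right)
    show "norm ((c \<bullet> f t)\<^sup>2) \<le> (norm c)\<^sup>2 * (norm (f t))\<^sup>2" for t
    proof -
      have "\<bar>c \<bullet> f t\<bar>\<^sup>2 \<le> (norm c * norm (f t))\<^sup>2"
        by (intro power_mono Cauchy_Schwarz_ineq2) auto
      then show ?thesis by (simp add: power_mult_distrib)
    qed
  qed auto
  ultimately show ?thesis by (simp add: L2_on_def)
qed

lemma H2_derivs_variation:
  assumes u: "H2_derivs a b u u1 u2"
    and h: "\<And>t. t \<in> {a..b} \<Longrightarrow> (h has_vector_derivative h1 t) (at t within {a..b})"
    and h1: "\<And>t. t \<in> {a..b} \<Longrightarrow> h1 t = h1 a + integral {a..t} h2" and h2: "L2_on h2 {a..b}"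
  shows "H2_derivs a b (\<lambda>t. u t + h t *\<^sub>R \<phi>) (\<lambda>t. u1 t + h1 t *\<^sub>R \<phi>) (\<lambda>t. u2 t + h2 t *\<^sub>R \<phi>)"
  unfolding H2_derivs_def
proof (intro conjI ballI)
  have h2a: "h2 absolutely_integrable_on {a..b}" using h2 by (rule L2_on_imp_absolutely_integrable)
  have h2p: "(\<lambda>t. h2 t *\<^sub>R \<phi>) absolutely_integrable_on {a..b}"
    using absolutely_integrable_linear[OF h2a bounded_linear_scaleR_left[of \<phi>]] by (simp add: o_def)
  show v2: "(\<lambda>t. u2 t + h2 t *\<^sub>R \<phi>) absolutely_integrable_on {a..b}"
    using H2_derivs_integrable[OF u] h2p by (intro set_integral_add)
  show "(\<lambda>t. (norm (u2 t + h2 t *\<^sub>R \<phi>))\<^sup>2) integrable_on {a..b}"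
  proof (rule measurable_bounded_by_integrable_imp_integrable)
    have "(\<lambda>t. u2 t + h2 t *\<^sub>R \<phi>) \<in> borel_measurable (lebesgue_on {a..b})"
      using v2 by (simp add: absolutely_integrable_measurable)
    then show "(\<lambda>t. (norm (u2 t + h2 t *\<^sub>R \<phi>))\<^sup>2) \<in> borel_measurable (lebesgue_on {a..b})"
      by simp
    show "(\<lambda>t. 2 * (norm (u2 t))\<^sup>2 + 2 * (norm \<phi>)\<^sup>2 * (h2 t)\<^sup>2) integrable_on {a..b}"
      using u h2 unfolding H2_derivs_def L2_on_def
      by (intro integrable_add integrable_on_mult_right) blast+
    show "norm ((norm (u2 t + h2 t *\<^sub>R \<phi>))\<^sup>2) \<le> 2 * (norm (u2 t))\<^sup>2 + 2 * (norm \<phi>)\<^sup>2 * (h2 t)\<^sup>2" for t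
    proof -
      let ?x = "norm (u2 t)" and ?y = "norm (h2 t *\<^sub>R \<phi>)"
      have "(norm (u2 t + h2 t *\<^sub>R \<phi>))\<^sup>2 \<le> (?x + ?y)\<^sup>2"
        by (intro power_mono norm_triangle_ineq) auto
      also have "\<dots> \<le> 2 * ?x\<^sup>2 + 2 * ?y\<^sup>2"
        using zero_le_power2[of "?x - ?y"] unfolding power2_sum power2_diff by linarith
      finally show ?thesis by (simp add: power_mult_distrib mult_ac)
    qed
  qed auto
  fix t assume t: "t \<in> {a..b}"
  show "((\<lambda>t. u t + h t *\<^sub>R \<phi>) has_vector_derivative u1 t + h1 t *\<^sub>R \<phi>) (at t within {a..b})"
    using u t bounded_linear.has_vector_derivative[OF bounded_linear_scaleR_left h[OF t]]
    unfolding H2_derivs_def by (intro has_vector_derivative_add) blast+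
  have "u2 integrable_on {a..t}" "h2 integrable_on {a..t}"
    using H2_derivs_integrable[OF u] h2a t
      integrable_subinterval_real[of u2 a b a t] integrable_subinterval_real[of h2 a b a t]
    by (simp_all add: absolutely_integrable_on_def)
  then have "integral {a..t} (\<lambda>t. u2 t + h2 t *\<^sub>R \<phi>) = integral {a..t} u2 + integral {a..t} h2 *\<^sub>R \<phi>"
    using integral_linear[OF _ bounded_linear_scaleR_left[of \<phi>], of h2 "{a..t}"]
      integrable_linear[OF _ bounded_linear_scaleR_left[of \<phi>], of h2 "{a..t}"]
    by (simp add: integral_add o_def)
  then show "u1 t + h1 t *\<^sub>R \<phi> = u1 a + h1 a *\<^sub>R \<phi> + integral {a..t} (\<lambda>t. u2 t + h2 t *\<^sub>R \<phi>)"
    unfolding H2_derivs_ftc[OF u t] h1[OF t] by (simp add: scaleR_add_left)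
qed

lemma inner_matrix_vector_transpose:
  fixes A :: "real ^ 'n ^ 'm"
  shows "x \<bullet> (A *v y) = (transpose A *v x) \<bullet> y"
  by (simp add: dot_lmul_matrix transpose_matrix_vector)

lemma sym_posdef_inverse:
  assumes "sym_posdef M"
  shows "M *v (matrix_inv M *v x) = x" "matrix_inv M *v (M *v x) = x"
proof -
  have "x = 0" if "M *v x = 0" for x
  proof (rule ccontr)
    assume "x \<noteq> 0"
    then have "x \<bullet> (M *v x) > 0" using assms unfolding sym_posdef_def by blast
    then show False using that by simp
  qed
  then have "invertible M"
    unfolding invertible_left_inverse matrix_left_invertible_ker by blast
  then have "M ** matrix_inv M = mat 1 \<and> matrix_inv M ** M = mat 1"
    unfolding invertible_def matrix_inv_def by (rule someI_ex)
  then show "M *v (matrix_inv M *v x) = x" "matrix_inv M *v (M *v x) = x"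
    by (simp_all add: matrix_vector_mul_assoc)
qed

text \<open>In coordinates the form is a finite sum of products of two square-integrable
  functions.\<close>

lemma integrable_quadratic_form:
  fixes r :: "real \<Rightarrow> real ^ 'n"
  assumes "\<And>c. L2_on (\<lambda>t. c \<bullet> r t) {a..b}"
  shows "(\<lambda>t. r t \<bullet> (P *v r t)) integrable_on {a..b}"
proof -
  have "(\<lambda>t. \<Sum>i\<in>UNIV. (axis i 1 \<bullet> r t) * (P $ i \<bullet> r t)) integrable_on {a..b}"
    using L2_on_mult[OF assms assms] by (intro integrable_sum) (auto simp: absolutely_integrable_on_def)
  moreover have "r t \<bullet> (P *v r t) = (\<Sum>i\<in>UNIV. (axis i 1 \<bullet> r t) * (P $ i \<bullet> r t))" for t
    by (subst inner_vec_def) (simp add: matrix_mult_dot inner_axis')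
  ultimately show ?thesis by simp
qed

lemma L2_on_residual:
  fixes M D K :: "real ^ 'n ^ 'n"
  assumes u: "H2_derivs a b u u1 u2"
  shows "L2_on (\<lambda>t. c \<bullet> (M *v u2 t + D *v u1 t + K *v u t + g)) {a..b}"
proof -
  have "L2_on (\<lambda>t. (transpose M *v c) \<bullet> u2 t) {a..b}"
    using u unfolding H2_derivs_def by (intro L2_on_inner) blast+
  moreover have "continuous_on {a..b} (\<lambda>t. (transpose D *v c) \<bullet> u1 t + (transpose K *v c) \<bullet> u t + c \<bullet> g)"
    using H2_derivs_continuous[OF u] by (intro continuous_intros)
  ultimately have "L2_on (\<lambda>t. (transpose M *v c) \<bullet> u2 t +
      ((transpose D *v c) \<bullet> u1 t + (transpose K *v c) \<bullet> u t + c \<bullet> g)) {a..b}"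
    by (rule L2_on_add[OF _ L2_on_continuous])
  then show ?thesis by (simp add: inner_add_right inner_matrix_vector_transpose add.assoc)
qed

text \<open>On an eigenvector both \<open>K\<close> and \<open>D\<close> act as multiples of
  \<open>M\<close>, so the variation shifts the residual by \<open>\<epsilon> * L t\<close> times
  \<open>M *v \<phi>\<close>. The weight \<open>matrix_inv M\<close> cancels this \<open>M\<close>,
  and the expansion in \<open>\<epsilon>\<close> is exact.\<close>

lemma energyE_variation:
  fixes M K :: "real ^ 'n ^ 'n" and \<phi> g :: "real ^ 'n" and \<alpha> \<beta> l :: real
    and h h1 h2 :: "real \<Rightarrow> real"
  assumes M: "sym_posdef M" and ab: "a < b"
    and eig: "K *v \<phi> = l *\<^sub>R (M *v \<phi>)" and orth: "\<phi> \<bullet> (M *v \<phi>) = 1"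
    and u: "H2_derivs a b u u1 u2"
    and h: "\<And>t. t \<in> {a..b} \<Longrightarrow> (h has_vector_derivative h1 t) (at t within {a..b})"
    and h1: "\<And>t. t \<in> {a..b} \<Longrightarrow> h1 t = h1 a + integral {a..t} h2" and h2: "L2_on h2 {a..b}"
  defines "D \<equiv> \<alpha> *\<^sub>R M + \<beta> *\<^sub>R K"
    and "R \<equiv> \<lambda>t. \<phi> \<bullet> (M *v u2 t + (\<alpha> *\<^sub>R M + \<beta> *\<^sub>R K) *v u1 t + K *v u t + g)"
    and "L \<equiv> \<lambda>t. h2 t + (\<alpha> + \<beta> * l) * h1 t + l * h t"
  shows "energyE M D K g a b (\<lambda>t. u t + (\<epsilon> * h t) *\<^sub>R \<phi>) = energyE M D K g a b u
           + \<epsilon> * integral {a..b} (\<lambda>t. R t * L t) + \<epsilon>\<^sup>2 * (1/2 * integral {a..b} (\<lambda>t. L t * L t))"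
proof -
  note inv = sym_posdef_inverse[OF M]
  have Ms: "transpose M = M" using M by (simp add: sym_posdef_def)
  have \<epsilon>h: "\<And>t. t \<in> {a..b} \<Longrightarrow> ((\<lambda>t. \<epsilon> * h t) has_vector_derivative \<epsilon> * h1 t) (at t within {a..b})"
    using h by (rule has_vector_derivative_mult_right)
  have \<epsilon>h1: "\<epsilon> * h1 t = \<epsilon> * h1 a + integral {a..t} (\<lambda>t. \<epsilon> * h2 t)" if "t \<in> {a..b}" for t
    unfolding h1[OF that] by (simp add: algebra_simps)
  have v: "H2_derivs a b (\<lambda>t. u t + (\<epsilon> * h t) *\<^sub>R \<phi>) (\<lambda>t. u1 t + (\<epsilon> * h1 t) *\<^sub>R \<phi>)
      (\<lambda>t. u2 t + (\<epsilon> * h2 t) *\<^sub>R \<phi>)"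
    by (rule H2_derivs_variation[OF u \<epsilon>h \<epsilon>h1 L2_on_cmult[OF h2]])
  define r where "r t = M *v u2 t + D *v u1 t + K *v u t + g" for t
  have Rr: "R t = \<phi> \<bullet> r t" for t by (simp add: R_def r_def D_def)
  have D\<phi>: "D *v \<phi> = (\<alpha> + \<beta> * l) *\<^sub>R (M *v \<phi>)"
    by (simp add: D_def matrix_vector_mult_add_rdistrib scaleR_matrix_vector_assoc[symmetric] eig algebra_simps)
  have rv: "M *v (u2 t + (\<epsilon> * h2 t) *\<^sub>R \<phi>) + D *v (u1 t + (\<epsilon> * h1 t) *\<^sub>R \<phi>)
       + K *v (u t + (\<epsilon> * h t) *\<^sub>R \<phi>) + g = r t + (\<epsilon> * L t) *\<^sub>R (M *v \<phi>)" for t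
    by (simp add: r_def L_def matrix_vector_right_distrib matrix_vector_mult_scaleR D\<phi> eig algebra_simps)
  have Q: "(r t + x *\<^sub>R (M *v \<phi>)) \<bullet> (matrix_inv M *v (r t + x *\<^sub>R (M *v \<phi>)))
      = r t \<bullet> (matrix_inv M *v r t) + 2 * x * R t + x\<^sup>2" for x t
  proof -
    have "(M *v \<phi>) \<bullet> (matrix_inv M *v r t) = R t"
      using inner_matrix_vector_transpose[of \<phi> M "matrix_inv M *v r t"] by (simp add: Ms inv Rr)
    then show ?thesis
      by (simp add: matrix_vector_right_distrib matrix_vector_mult_scaleR inv inner_add_left inner_add_right
          inner_commute[of "M *v \<phi>" \<phi>] orth inner_commute[of "r t" \<phi>] Rr[symmetric] power2_eq_square algebra_simps)
  qed
  have ch1: "continuous_on {a..b} h1"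
  proof -
    have "continuous_on {a..b} (\<lambda>t. h1 a + integral {a..t} h2)"
      using L2_on_imp_absolutely_integrable[OF h2] unfolding absolutely_integrable_on_def
      by (intro continuous_intros indefinite_integral_continuous_1) blast
    then show ?thesis by (rule continuous_on_eq) (metis h1)
  qed
  have ch: "continuous_on {a..b} h"
    using h unfolding continuous_on_eq_continuous_within by (meson has_vector_derivative_continuous)
  have LL: "L2_on L {a..b}" unfolding L_def
    by (intro L2_on_add L2_on_cmult h2 L2_on_continuous ch1 ch)
  have LR: "L2_on R {a..b}" unfolding R_def using L2_on_residual[OF u] .
  have i1: "(\<lambda>t. r t \<bullet> (matrix_inv M *v r t)) integrable_on {a..b}"
    unfolding r_def by (rule integrable_quadratic_form[OF L2_on_residual[OF u]])
  have i2: "(\<lambda>t. R t * L t) integrable_on {a..b}" "(\<lambda>t. L t * L t) integrable_on {a..b}"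
    using L2_on_mult[OF LR LL] L2_on_mult[OF LL LL] by (simp_all add: absolutely_integrable_on_def)
  have "energyE M D K g a b (\<lambda>t. u t + (\<epsilon> * h t) *\<^sub>R \<phi>) = 1/2 * integral {a..b} (\<lambda>t.
      r t \<bullet> (matrix_inv M *v r t) + 2 * \<epsilon> * (R t * L t) + \<epsilon>\<^sup>2 * (L t * L t))"
    unfolding energyE_eq[OF v ab] rv Q by (simp add: power2_eq_square mult_ac)
  also have "\<dots> = 1/2 * (integral {a..b} (\<lambda>t. r t \<bullet> (matrix_inv M *v r t))
      + 2 * \<epsilon> * integral {a..b} (\<lambda>t. R t * L t) + \<epsilon>\<^sup>2 * integral {a..b} (\<lambda>t. L t * L t))"
    using i1 i2 by (simp add: integral_add integrable_add integrable_on_mult_right)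
  finally show ?thesis
    unfolding energyE_eq[OF u ab] r_def[symmetric] by (simp add: algebra_simps)
qed

lemma quadratic_nonneg_linear_zero:
  fixes x y :: real
  assumes "\<And>\<epsilon>. 0 \<le> \<epsilon> * x + \<epsilon>\<^sup>2 * y"
  shows "x = 0"
proof (rule ccontr)
  assume x: "x \<noteq> 0"
  \<comment> \<open>This is the minimum point of the quadratic after \<open>y\<close> is replaced by
    the larger, positive coefficient \<open>\<bar>y\<bar> + 1\<close>.\<close>
  define \<epsilon> where "\<epsilon> = - x / (2 * (\<bar>y\<bar> + 1))"
  have "\<epsilon> * x + \<epsilon>\<^sup>2 * y \<le> \<epsilon> * x + \<epsilon>\<^sup>2 * (\<bar>y\<bar> + 1)"
    by (intro add_left_mono mult_left_mono) auto
  also have "\<dots> = \<epsilon> * (x + \<epsilon> * (\<bar>y\<bar> + 1))" by (simp add: power2_eq_square algebra_simps)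
  also have "\<epsilon> * (\<bar>y\<bar> + 1) = - x / 2" by (simp add: \<epsilon>_def field_simps)
  also have "\<epsilon> * (x + - x / 2) = - (x\<^sup>2 / (4 * (\<bar>y\<bar> + 1)))"
    by (simp add: \<epsilon>_def power2_eq_square)
  also have "\<dots> < 0" using x by simp
  finally show False using assms[of \<epsilon>] by linarith
qed

section \<open>Localized test functions and the weak Euler-Lagrange equation\<close>

text \<open>Zero mean over \<open>{p..r}\<close> makes the primitive return to 0 at
  \<open>r\<close>, so extension by zero commutes with taking primitives.\<close>

lemma integral_cutoff:
  fixes f :: "real \<Rightarrow> real"
  assumes "a \<le> p" "integral {p..r} f = 0" "a \<le> t"
  shows "integral {a..t} (\<lambda>x. if x \<in> {p..r} then f x else 0) = (if t \<in> {p..r} then integral {p..t} f else 0)"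
proof -
  have "integral {a..t} (\<lambda>x. if x \<in> {p..r} then f x else 0) = integral ({p..r} \<inter> {a..t}) f"
    by (rule integral_restrict_Int)
  also have "{p..r} \<inter> {a..t} = (if t < p then {} else if t \<le> r then {p..t} else {p..r})"
    using assms by auto
  finally show ?thesis using assms(2) by auto
qed

lemma L2_on_cutoff:
  assumes h: "L2_on h {p..r}" and sub: "{p..r} \<subseteq> {a..b}"
  shows "L2_on (\<lambda>x. if x \<in> {p..r} then h x else 0) {a..b}"
proof -
  have 1: "h absolutely_integrable_on {p..r}" using h by (rule L2_on_imp_absolutely_integrable)
  have int: "(\<lambda>x. if x \<in> {p..r} then f x else 0) integrable_on {a..b}" if "f integrable_on {p..r}"
    for f :: "real \<Rightarrow> real"
    using that has_integral_restrict[OF sub, of f] unfolding integrable_on_def by blast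
  have "(\<lambda>x. if x \<in> {p..r} then h x else 0) absolutely_integrable_on {a..b}"
    using 1 int[of h] int[of "\<lambda>x. norm (h x)"] unfolding absolutely_integrable_on_def
    by (simp add: if_distrib cong: if_cong)
  then have "(\<lambda>x. if x \<in> {p..r} then h x else 0) \<in> borel_measurable (lebesgue_on {a..b})"
    by (simp add: absolutely_integrable_measurable)
  moreover have "(\<lambda>x. (if x \<in> {p..r} then h x else 0)\<^sup>2) integrable_on {a..b}"
    using h int[of "\<lambda>x. (h x)\<^sup>2"] unfolding L2_on_def
    by (simp add: if_distrib[of "\<lambda>y. y\<^sup>2"] cong: if_cong)
  ultimately show ?thesis unfolding L2_on_def by blast
qed

text \<open>The conditions at the nodes leave \<open>energyC\<close> unchanged along the variation,
  so minimality concerns \<open>energyE\<close> alone, whose increment is a quadratic polynomial in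
  \<open>\<epsilon>\<close> without constant term.\<close>

lemma minimizer_weak_equation:
  fixes M K :: "real ^ 'n ^ 'n" and \<phi> g :: "real ^ 'n" and \<alpha> \<beta> l :: real and h h1 h2 :: "real \<Rightarrow> real"
    and t :: "nat \<Rightarrow> real"
  assumes M: "sym_posdef M" and ab: "t 0 < t m"
    and tk: "\<And>k. k \<le> m \<Longrightarrow> t k \<in> {t 0..t m}"
    and eig: "K *v \<phi> = l *\<^sub>R (M *v \<phi>)" and orth: "\<phi> \<bullet> (M *v \<phi>) = 1"
    and u: "H2_derivs (t 0) (t m) u u1 u2"
    and umin: "\<And>v. H2 (t 0) (t m) v \<Longrightarrow>
        energyE M (\<alpha> *\<^sub>R M + \<beta> *\<^sub>R K) K g (t 0) (t m) u + energyC cA cB A a B b t m u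
        \<le> energyE M (\<alpha> *\<^sub>R M + \<beta> *\<^sub>R K) K g (t 0) (t m) v + energyC cA cB A a B b t m v"
    and h: "\<And>s. s \<in> {t 0..t m} \<Longrightarrow> (h has_vector_derivative h1 s) (at s within {t 0..t m})"
    and h1: "\<And>s. s \<in> {t 0..t m} \<Longrightarrow> h1 s = h1 (t 0) + integral {t 0..s} h2" and h2: "L2_on h2 {t 0..t m}"
    and h0: "\<And>k. k \<le> m \<Longrightarrow> h (t k) = 0" and h10: "\<And>k. k \<le> m \<Longrightarrow> B k \<noteq> [] \<Longrightarrow> h1 (t k) = 0"
  shows "integral {t 0..t m} (\<lambda>s. (\<phi> \<bullet> (M *v u2 s + (\<alpha> *\<^sub>R M + \<beta> *\<^sub>R K) *v u1 s + K *v u s + g))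
      * (h2 s + (\<alpha> + \<beta> * l) * h1 s + l * h s)) = 0"
proof (rule quadratic_nonneg_linear_zero)
  fix \<epsilon> :: real
  let ?v = "\<lambda>s. u s + (\<epsilon> * h s) *\<^sub>R \<phi>"
  have \<epsilon>h: "\<And>s. s \<in> {t 0..t m} \<Longrightarrow> ((\<lambda>s. \<epsilon> * h s) has_vector_derivative \<epsilon> * h1 s) (at s within {t 0..t m})"
    using h by (rule has_vector_derivative_mult_right)
  have \<epsilon>h1: "\<epsilon> * h1 s = \<epsilon> * h1 (t 0) + integral {t 0..s} (\<lambda>s. \<epsilon> * h2 s)" if "s \<in> {t 0..t m}" for s
    unfolding h1[OF that] by (simp add: algebra_simps)
  have v: "H2_derivs (t 0) (t m) ?v (\<lambda>s. u1 s + (\<epsilon> * h1 s) *\<^sub>R \<phi>) (\<lambda>s. u2 s + (\<epsilon> * h2 s) *\<^sub>R \<phi>)"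
    by (rule H2_derivs_variation[OF u \<epsilon>h \<epsilon>h1 L2_on_cmult[OF h2]])
  have "energyC cA cB A a B b t m ?v = energyC cA cB A a B b t m u"
  proof -
    have "resid2 (B k) (b k) (vel (t 0) (t m) ?v (t k)) = resid2 (B k) (b k) (vel (t 0) (t m) u (t k))"
      if k: "k \<le> m" for k
    \<comment> \<open>With no rows, \<open>resid2\<close> is an empty sum, so the velocity at that
      node may change freely.\<close>
    proof (cases "B k = []")
      case False
      then show ?thesis
        using H2_derivs_vel[OF v ab tk[OF k]] H2_derivs_vel[OF u ab tk[OF k]] h10[OF k] by simp
    qed (simp add: resid2_def)
    then show ?thesis unfolding energyC_def using h0 by simp
  qed
  moreover have "H2 (t 0) (t m) ?v" using v H2_iff by blast
  ultimately have "energyE M (\<alpha> *\<^sub>R M + \<beta> *\<^sub>R K) K g (t 0) (t m) u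
      \<le> energyE M (\<alpha> *\<^sub>R M + \<beta> *\<^sub>R K) K g (t 0) (t m) ?v"
    using umin[of ?v] by simp
  then show "0 \<le> \<epsilon> * integral {t 0..t m} (\<lambda>s. (\<phi> \<bullet> (M *v u2 s + (\<alpha> *\<^sub>R M + \<beta> *\<^sub>R K) *v u1 s + K *v u s + g))
      * (h2 s + (\<alpha> + \<beta> * l) * h1 s + l * h s)) + \<epsilon>\<^sup>2 * (1/2 * integral {t 0..t m} (\<lambda>s.
         (h2 s + (\<alpha> + \<beta> * l) * h1 s + l * h s) * (h2 s + (\<alpha> + \<beta> * l) * h1 s + l * h s)))"
    using energyE_variation[OF M ab eig orth u h h1 h2, where \<alpha> = \<alpha> and \<beta> = \<beta> and g = g and \<epsilon> = \<epsilon>]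
    by linarith
qed

text \<open>Every \<open>h\<close> on \<open>{p..r}\<close> with the three vanishing moments extends
  by zero to an admissible second derivative on the whole time interval. By \<open>nodes\<close>,
  only \<open>q\<close>, without a prescribed velocity, can be a node strictly inside.\<close>

lemma minimizer_residual_mode:
  fixes M K :: "real ^ 'n ^ 'n" and \<phi> g :: "real ^ 'n" and \<alpha> \<beta> l :: real and t :: "nat \<Rightarrow> real"
  assumes M: "sym_posdef M" and ab: "t 0 < t m"
    and tk: "\<And>k. k \<le> m \<Longrightarrow> t k \<in> {t 0..t m}"
    and eig: "K *v \<phi> = l *\<^sub>R (M *v \<phi>)" and orth: "\<phi> \<bullet> (M *v \<phi>) = 1"
    and u: "H2_derivs (t 0) (t m) u u1 u2"
    and umin: "\<And>v. H2 (t 0) (t m) v \<Longrightarrow>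
        energyE M (\<alpha> *\<^sub>R M + \<beta> *\<^sub>R K) K g (t 0) (t m) u + energyC cA cB A a B b t m u
        \<le> energyE M (\<alpha> *\<^sub>R M + \<beta> *\<^sub>R K) K g (t 0) (t m) v + energyC cA cB A a B b t m v"
    and pqr: "t 0 \<le> p" "p \<le> q" "q \<le> r" "r \<le> t m"
    and nodes: "\<And>k. k \<le> m \<Longrightarrow> t k \<le> p \<or> r \<le> t k \<or> (t k = q \<and> B k = [])"
  defines "R \<equiv> \<lambda>s. \<phi> \<bullet> (M *v u2 s + (\<alpha> *\<^sub>R M + \<beta> *\<^sub>R K) *v u1 s + K *v u s + g)"
  obtains c0 c1 c2 N where "negligible N"
    "\<And>x. x \<in> {p..r} - N \<Longrightarrow> R x = c0 + c1 * (r - x) + c2 * max 0 (q - x)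
       + (\<alpha> + \<beta> * l) * integral {p..x} R - l * integral {p..x} (\<lambda>y. integral {p..y} R)"
proof -
  have sub: "{p..r} \<subseteq> {t 0..t m}" and pr: "p \<le> r" using pqr by auto
  have LR: "L2_on R {p..r}"
    unfolding R_def by (rule L2_on_subinterval[OF L2_on_residual[OF u] sub])
  have van: "integral {p..r} (\<lambda>x. R x * (h x + 2 * ((\<alpha> + \<beta> * l) / 2) * integral {p..x} h
          + l * integral {p..x} (\<lambda>y. integral {p..y} h))) = 0"
    if h: "L2_on h {p..r}" and m0: "integral {p..r} h = 0" and m1: "integral {p..r} (\<lambda>x. (r - x) * h x) = 0"
      and m2: "integral {p..r} (\<lambda>x. max 0 (q - x) * h x) = 0" for h
  proof -
    have ha: "h absolutely_integrable_on {p..r}" using h by (rule L2_on_imp_absolutely_integrable)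
    have haq: "h absolutely_integrable_on {p..q}"
      using absolutely_integrable_on_subinterval[OF ha, of p q] pqr by auto
    define h1 where "h1 x = integral {p..x} h" for x
    have h1r: "integral {p..r} h1 = 0" "integral {p..q} h1 = 0"
      using double_integral_eq[OF pr ha] m1 double_integral_eq[OF pqr(2) haq]
        integral_max_weight[OF pqr(2,3) ha] m2 by (simp_all add: h1_def[abs_def])
    \<comment> \<open>\<open>e0\<close> is the global test function; \<open>e1\<close> and
      \<open>e2\<close> are its first and second derivatives, the latter in the weak sense.\<close>
    define e2 where "e2 x = (if x \<in> {p..r} then h x else 0)" for x
    define e1 where "e1 x = (if x \<in> {p..r} then h1 x else 0)" for x
    define e0 where "e0 x = (if x \<in> {p..r} then integral {p..x} h1 else 0)" for x
    have i2: "integral {t 0..s} e2 = e1 s" if "t 0 \<le> s" for s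
      unfolding e2_def[abs_def] e1_def h1_def by (rule integral_cutoff[OF pqr(1) m0 that])
    have i1: "integral {t 0..s} e1 = e0 s" if "t 0 \<le> s" for s
      unfolding e1_def[abs_def] e0_def by (rule integral_cutoff[OF pqr(1) h1r(1) that])
    have L: "L2_on e2 {t 0..t m}" unfolding e2_def[abs_def] by (rule L2_on_cutoff[OF h sub])
    have "continuous_on {t 0..t m} (\<lambda>s. integral {t 0..s} e2)"
      using L2_on_imp_absolutely_integrable[OF L] unfolding absolutely_integrable_on_def
      by (intro indefinite_integral_continuous_1) blast
    then have ce1: "continuous_on {t 0..t m} e1"
      by (rule continuous_on_eq) (simp add: i2)
    have d: "(e0 has_vector_derivative e1 s) (at s within {t 0..t m})" if s: "s \<in> {t 0..t m}" for s
    proof (rule has_vector_derivative_transform[OF s])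
      show "((\<lambda>s. integral {t 0..s} e1) has_vector_derivative e1 s) (at s within {t 0..t m})"
        by (rule integral_has_vector_derivative[OF ce1 s])
    qed (simp add: i1)
    have ftc: "e1 s = e1 (t 0) + integral {t 0..s} e2" if "s \<in> {t 0..t m}" for s
      using i2[of s] i2[of "t 0"] that by simp
    \<comment> \<open>The third moment condition handles a node at \<open>q\<close>. No such
      condition is imposed on \<open>e1\<close> there, because a node strictly inside has no
      velocity term.\<close>
    have e0k: "e0 (t k) = 0" if "k \<le> m" for k
      using nodes[OF that] h1r pqr unfolding e0_def by auto
    have e1k: "e1 (t k) = 0" if "k \<le> m" "B k \<noteq> []" for k
      using nodes[OF that(1)] that(2) m0 pqr unfolding e1_def h1_def by auto
    have "0 = integral {t 0..t m} (\<lambda>s. R s * (e2 s + (\<alpha> + \<beta> * l) * e1 s + l * e0 s))"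
      unfolding R_def
      by (rule sym, rule minimizer_weak_equation[OF M ab tk eig orth u umin d ftc L e0k e1k])
    also have "\<dots> = integral {t 0..t m} (\<lambda>s. if s \<in> {p..r} then
        R s * (h s + (\<alpha> + \<beta> * l) * h1 s + l * integral {p..s} h1) else 0)"
      by (intro integral_cong) (simp add: e2_def e1_def e0_def)
    also have "\<dots> = integral {p..r} (\<lambda>s. R s * (h s + (\<alpha> + \<beta> * l) * h1 s + l * integral {p..s} h1))"
      by (subst integral_restrict_Int) (simp only: inf.absorb1[OF sub])
    finally have 0: "0 = integral {p..r} (\<lambda>s. R s * (h s + (\<alpha> + \<beta> * l) * h1 s + l * integral {p..s} h1))" .
    have 2: "2 * ((\<alpha> + \<beta> * l) / 2) = \<alpha> + \<beta> * l" by simp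
    show ?thesis unfolding 2 using 0[symmetric] unfolding h1_def[abs_def] .
  qed
  have 2: "2 * ((\<alpha> + \<beta> * l) / 2) = \<alpha> + \<beta> * l" by simp
  show ?thesis
    by (rule weak_adjoint_equation[OF pqr(2,3) LR, where \<delta> = "(\<alpha> + \<beta> * l) / 2" and l = l, unfolded 2],
        erule (3) van[unfolded 2], rule that)
qed

section \<open>Regularity of minimizers\<close>

text \<open>Closed forms of iterated derivatives are known only on \<open>S\<close>; openness allows
  them to be differentiated once more.\<close>

lemma deriv_eq_on_open:
  fixes f F :: "real \<Rightarrow> real"
  assumes "open S" "\<And>x. x \<in> S \<Longrightarrow> f x = F x" "\<And>x. x \<in> S \<Longrightarrow> (F has_field_derivative F' x) (at x)" "x \<in> S"
  shows "(f has_field_derivative F' x) (at x)" "deriv f x = F' x"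
proof -
  show "(f has_field_derivative F' x) (at x)"
    using assms(2) by (intro has_field_derivative_transform_within_open[OF assms(3)[OF assms(4)] assms(1,4)]) simp
  then show "deriv f x = F' x" by (rule DERIV_imp_deriv)
qed

text \<open>\<^term>\<open>\<rho>\<close> solves the adjoint equation \<^term>\<open>\<rho>'' - d * \<rho>' + l * \<rho> = 0\<close>; eliminating it
  from \<^term>\<open>w'' + d * w' + l * w + \<gamma> = \<rho>\<close> gives the fourth-order equation.\<close>
lemma wiggly_spline_equation:
  fixes w w1 \<rho> \<sigma> :: "real \<Rightarrow> real"
  assumes S: "open S"
    and w: "\<And>x. x \<in> S \<Longrightarrow> (w has_field_derivative w1 x) (at x)"
    and w1: "\<And>x. x \<in> S \<Longrightarrow> (w1 has_field_derivative \<rho> x - d * w1 x - l * w x - \<gamma>) (at x)"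
    and \<rho>: "\<And>x. x \<in> S \<Longrightarrow> (\<rho> has_field_derivative \<sigma> x) (at x)"
    and \<sigma>: "\<And>x. x \<in> S \<Longrightarrow> (\<sigma> has_field_derivative d * \<sigma> x - l * \<rho> x) (at x)"
  shows "smooth_on w S"
    and "x \<in> S \<Longrightarrow> (deriv ^^ 4) w x + (2 * l - d\<^sup>2) * (deriv ^^ 2) w x + l * (l * w x + \<gamma>) = 0"
proof -
  define w2 where "w2 x = \<rho> x - d * w1 x - l * w x - \<gamma>" for x
  define w3 where "w3 x = \<sigma> x - d * w2 x - l * w1 x" for x
  define w4 where "w4 x = d * \<sigma> x - l * \<rho> x - d * w3 x - l * w2 x" for x
  have w1': "\<And>x. x \<in> S \<Longrightarrow> (w1 has_field_derivative w2 x) (at x)" using w1 by (simp add: w2_def)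
  have w2': "(w2 has_field_derivative w3 x) (at x)" if "x \<in> S" for x
    unfolding w2_def[abs_def] w3_def
    by (rule derivative_eq_intros w w1' \<rho> refl that | simp add: w2_def)+
  have w3': "(w3 has_field_derivative w4 x) (at x)" if "x \<in> S" for x
    unfolding w3_def[abs_def] w4_def
    by (rule derivative_eq_intros w1' w2' \<sigma> refl that | simp add: w3_def)+
  have d1: "(deriv ^^ 1) w x = w1 x" if "x \<in> S" for x
    using deriv_eq_on_open(2)[OF S refl w that] by simp
  have d2: "(deriv ^^ 2) w x = w2 x" if "x \<in> S" for x
    using deriv_eq_on_open(2)[OF S d1 w1' that] by (simp add: eval_nat_numeral)
  have d3: "(deriv ^^ 3) w x = w3 x" if "x \<in> S" for x
    using deriv_eq_on_open(2)[OF S d2 w2' that] by (simp add: eval_nat_numeral)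
  have d4: "(deriv ^^ 4) w x = w4 x" if "x \<in> S" for x
    using deriv_eq_on_open(2)[OF S d3 w3' that] by (simp add: eval_nat_numeral)
  \<comment> \<open>With D for differentiation, the product of \<open>D^2 + d D + l\<close> and
    \<open>D^2 - d D + l\<close> is \<open>D^4 + (2 l - d^2) D^2 + l^2\<close>; the odd orders
    cancel.\<close>
  show "(deriv ^^ 4) w x + (2 * l - d\<^sup>2) * (deriv ^^ 2) w x + l * (l * w x + \<gamma>) = 0" if "x \<in> S"
    unfolding d4[OF that] d2[OF that] w4_def w3_def w2_def
    by (simp add: algebra_simps power2_eq_square)
  \<comment> \<open>The span of 1, \<open>w\<close>, \<open>w1\<close>, \<open>\<rho>\<close> and
    \<open>\<sigma>\<close> is closed under differentiation on \<open>S\<close>. Every iterated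
    derivative of \<open>w\<close> therefore stays in it, which gives smoothness.\<close>
  define C where "C c x = c 0 + c 1 * w x + c 2 * w1 x + c 3 * \<rho> x + c 4 * \<sigma> x" for c :: "nat \<Rightarrow> real" and x
  have C': "\<exists>c'. \<forall>x\<in>S. (C c has_field_derivative C c' x) (at x)" for c
  proof -
    define c' where "c' = (\<lambda>i::nat. if i = 0 then - c 2 * \<gamma> else if i = 1 then - c 2 * l
      else if i = 2 then c 1 - c 2 * d else if i = 3 then c 2 - c 4 * l else c 3 + c 4 * d)"
    have "(C c has_field_derivative C c' x) (at x)" if "x \<in> S" for x
      unfolding C_def[abs_def]
      by (rule derivative_eq_intros w w1 \<rho> \<sigma> refl that | simp add: c'_def algebra_simps)+
    then show ?thesis by blast
  qed
  have ex: "\<exists>c. \<forall>x\<in>S. (deriv ^^ j) w x = C c x" for j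
  proof (induction j)
    case 0
    then show ?case by (intro exI[of _ "\<lambda>i. if i = 1 then 1 else 0"]) (simp add: C_def)
  next
    case (Suc j)
    then obtain c c' where "\<forall>x\<in>S. (deriv ^^ j) w x = C c x" "\<forall>x\<in>S. (C c has_field_derivative C c' x) (at x)"
      using C' by blast
    then have "\<forall>x\<in>S. deriv ((deriv ^^ j) w) x = C c' x"
      using deriv_eq_on_open(2)[OF S, of "(deriv ^^ j) w" "C c" "C c'"] by blast
    then show ?case by auto
  qed
  show "smooth_on w S"
    unfolding smooth_on_def
  proof (intro allI ballI)
    fix j x assume x: "x \<in> S"
    obtain c c' where "\<forall>x\<in>S. (deriv ^^ j) w x = C c x" "\<forall>x\<in>S. (C c has_field_derivative C c' x) (at x)"
      using C' ex by blast
    then have "((deriv ^^ j) w has_field_derivative C c' x) (at x)"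
      using deriv_eq_on_open(1)[OF S, of "(deriv ^^ j) w" "C c" "C c'"] x by blast
    then show "(deriv ^^ j) w differentiable (at x)"
      unfolding real_differentiable_def by blast
  qed
qed

text \<open>Changing the integrand on a null set does not change \<open>G\<close>, so the
  fundamental theorem applies with the continuous representative at every point, endpoints
  included.\<close>

lemma has_vector_derivative_ae_continuous:
  fixes f g G :: "real \<Rightarrow> real"
  assumes f: "continuous_on {p..r} f" and N: "negligible N" "\<And>x. x \<in> {p..r} - N \<Longrightarrow> g x = f x"
    and G: "\<And>t. t \<in> {p..r} \<Longrightarrow> G t = G p + integral {p..t} g" and t: "t \<in> {p..r}"
  shows "(G has_vector_derivative f t) (at t within {p..r})"
proof (rule has_vector_derivative_transform[OF t])
  show "((\<lambda>t. G p + integral {p..t} f) has_vector_derivative f t) (at t within {p..r})"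
    using has_vector_derivative_add[OF has_vector_derivative_const integral_has_vector_derivative[OF f t], of "G p"]
    by simp
  fix x assume x: "x \<in> {p..r}"
  have "integral {p..x} g = integral {p..x} f"
    by (rule sym, rule integral_spike[OF N(1)]) (use N(2) x in auto)
  then show "G x = G p + integral {p..x} f" using G[OF x] by simp
qed

lemma H2_derivs_mode:
  assumes u: "H2_derivs a b u u1 u2" and sub: "a \<le> p" "r \<le> b" and t: "t \<in> {p..r}"
  shows "c \<bullet> u1 t = c \<bullet> u1 p + integral {p..t} (\<lambda>s. c \<bullet> u2 s)"
    and "((\<lambda>s. c \<bullet> u s) has_vector_derivative c \<bullet> u1 t) (at t within {p..r})"
proof -
  have u2: "u2 integrable_on {a..t}"
    using H2_derivs_integrable(2)[OF u] integrable_subinterval_real[of u2 a b a t] sub t by simp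
  have u2': "u2 integrable_on {p..t}"
    using integrable_subinterval_real[OF u2, of p t] sub t by simp
  have "integral {a..p} u2 + integral {p..t} u2 = integral {a..t} u2"
    using sub t by (intro Henstock_Kurzweil_Integration.integral_combine u2) auto
  then have "u1 t = u1 p + integral {p..t} u2"
    using H2_derivs_ftc[OF u, of t] H2_derivs_ftc[OF u, of p] sub t by simp
  moreover have "integral {p..t} (\<lambda>s. c \<bullet> u2 s) = c \<bullet> integral {p..t} u2"
    using integral_linear[OF u2' bounded_linear_inner_right[of c]] by (simp add: o_def)
  ultimately show "c \<bullet> u1 t = c \<bullet> u1 p + integral {p..t} (\<lambda>s. c \<bullet> u2 s)"
    by (simp add: inner_add_right)
  have "t \<in> {a..b}" using sub t by simp
  with u have "(u has_vector_derivative u1 t) (at t within {a..b})"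
    unfolding H2_derivs_def by blast
  then have "(u has_vector_derivative u1 t) (at t within {p..r})"
    by (rule has_vector_derivative_within_subset) (use sub in auto)
  then show "((\<lambda>s. c \<bullet> u s) has_vector_derivative c \<bullet> u1 t) (at t within {p..r})"
    by (rule bounded_linear.has_vector_derivative[OF bounded_linear_inner_right])
qed

text \<open>The right-hand side of the identity for the residual mode is continuous and serves as
  its representative \<open>\<rho>\<close>. Solving the residual for the second derivative makes the
  mode's velocity classically differentiable, even across \<open>q\<close>.\<close>

lemma minimizer_mode_regularity:
  fixes M K :: "real ^ 'n ^ 'n" and \<phi> g :: "real ^ 'n" and \<alpha> \<beta> l :: real and t :: "nat \<Rightarrow> real"
  assumes M: "sym_posdef M" and K: "transpose K = K" and ab: "t 0 < t m"
    and tk: "\<And>k. k \<le> m \<Longrightarrow> t k \<in> {t 0..t m}"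
    and eig: "K *v \<phi> = l *\<^sub>R (M *v \<phi>)" and orth: "\<phi> \<bullet> (M *v \<phi>) = 1"
    and u: "H2_derivs (t 0) (t m) u u1 u2"
    and umin: "\<And>v. H2 (t 0) (t m) v \<Longrightarrow>
        energyE M (\<alpha> *\<^sub>R M + \<beta> *\<^sub>R K) K g (t 0) (t m) u + energyC cA cB A a B b t m u
        \<le> energyE M (\<alpha> *\<^sub>R M + \<beta> *\<^sub>R K) K g (t 0) (t m) v + energyC cA cB A a B b t m v"
    and pqr: "t 0 \<le> p" "p \<le> q" "q \<le> r" "r \<le> t m"
    and nodes: "\<And>k. k \<le> m \<Longrightarrow> t k \<le> p \<or> r \<le> t k \<or> (t k = q \<and> B k = [])"
  obtains c0 c1 c2 \<rho> where "continuous_on {p..r} \<rho>"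
    "\<And>x. x \<in> {p..r} \<Longrightarrow> \<rho> x = c0 + c1 * (r - x) + c2 * max 0 (q - x)
       + (\<alpha> + \<beta> * l) * integral {p..x} \<rho> - l * integral {p..x} (\<lambda>y. integral {p..y} \<rho>)"
    "\<And>x. x \<in> {p..r} \<Longrightarrow> ((\<lambda>s. \<phi> \<bullet> (M *v u1 s)) has_vector_derivative
       \<rho> x - (\<alpha> + \<beta> * l) * (\<phi> \<bullet> (M *v u1 x)) - l * (\<phi> \<bullet> (M *v u x)) - \<phi> \<bullet> g) (at x within {p..r})"
proof -
  define R where "R s = \<phi> \<bullet> (M *v u2 s + (\<alpha> *\<^sub>R M + \<beta> *\<^sub>R K) *v u1 s + K *v u s + g)" for s
  define d where "d = \<alpha> + \<beta> * l"
  have sub: "{p..r} \<subseteq> {t 0..t m}" using pqr by auto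
  have Ms: "transpose M = M" using M by (simp add: sym_posdef_def)
  have M\<phi>: "\<phi> \<bullet> (M *v x) = (M *v \<phi>) \<bullet> x" for x
    using inner_matrix_vector_transpose[of \<phi> M x] by (simp add: Ms)
  have K\<phi>: "\<phi> \<bullet> (K *v x) = l * (\<phi> \<bullet> (M *v x))" for x
    using inner_matrix_vector_transpose[of \<phi> K x] by (simp add: K eig M\<phi>)
  have R: "R s = \<phi> \<bullet> (M *v u2 s) + d * (\<phi> \<bullet> (M *v u1 s)) + l * (\<phi> \<bullet> (M *v u s)) + \<phi> \<bullet> g" for s
    by (simp add: R_def d_def inner_add_right matrix_vector_mult_add_rdistrib
        scaleR_matrix_vector_assoc[symmetric] K\<phi> algebra_simps)
  have "\<exists>c0 c1 c2 N. negligible N \<and> (\<forall>x\<in>{p..r} - N. R x = c0 + c1 * (r - x) + c2 * max 0 (q - x)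
       + d * integral {p..x} R - l * integral {p..x} (\<lambda>y. integral {p..y} R))"
    unfolding R_def[abs_def] d_def
    by (rule minimizer_residual_mode[OF M ab tk eig orth u umin pqr nodes])
       (assumption | intro exI conjI, assumption, blast)+
  then obtain c0 c1 c2 N where N: "negligible N"
    and ae: "\<And>x. x \<in> {p..r} - N \<Longrightarrow> R x = c0 + c1 * (r - x) + c2 * max 0 (q - x)
       + d * integral {p..x} R - l * integral {p..x} (\<lambda>y. integral {p..y} R)"
    by blast
  define \<rho> where "\<rho> x = c0 + c1 * (r - x) + c2 * max 0 (q - x)
       + d * integral {p..x} R - l * integral {p..x} (\<lambda>y. integral {p..y} R)" for x
  have "R integrable_on {p..r}"
    using L2_on_imp_absolutely_integrable[OF L2_on_subinterval[OF L2_on_residual[OF u] sub]]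
    unfolding R_def absolutely_integrable_on_def by blast
  then have cR1: "continuous_on {p..r} (\<lambda>x. integral {p..x} R)"
    by (rule indefinite_integral_continuous_1)
  then have cR2: "continuous_on {p..r} (\<lambda>x. integral {p..x} (\<lambda>y. integral {p..y} R))"
    by (rule indefinite_integral_continuous_1[OF integrable_continuous_interval])
  have c\<rho>: "continuous_on {p..r} \<rho>"
    unfolding \<rho>_def[abs_def] by (intro continuous_intros cR1 cR2)
  have R\<rho>: "R x = \<rho> x" if "x \<in> {p..r} - N" for x using ae[OF that] by (simp add: \<rho>_def)
  \<comment> \<open>Integrals ignore null sets, so \<open>\<rho>\<close> satisfies the integral
    equation with itself in place of \<open>R\<close>.\<close>
  have i1: "integral {p..x} R = integral {p..x} \<rho>" if "x \<in> {p..r}" for x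
    by (rule sym, rule integral_spike[OF N]) (use R\<rho> that in auto)
  have i2: "integral {p..x} (\<lambda>y. integral {p..y} R) = integral {p..x} (\<lambda>y. integral {p..y} \<rho>)"
    if "x \<in> {p..r}" for x
    by (rule integral_cong) (use i1 that in auto)
  show ?thesis
  proof (rule that)
    show "continuous_on {p..r} \<rho>" by (rule c\<rho>)
    show "\<rho> x = c0 + c1 * (r - x) + c2 * max 0 (q - x)
       + (\<alpha> + \<beta> * l) * integral {p..x} \<rho> - l * integral {p..x} (\<lambda>y. integral {p..y} \<rho>)"
      if "x \<in> {p..r}" for x
      unfolding i1[OF that, symmetric] i2[OF that, symmetric] by (simp add: \<rho>_def d_def)
    fix x assume x: "x \<in> {p..r}"
    let ?f = "\<lambda>x. \<rho> x - d * (\<phi> \<bullet> (M *v u1 x)) - l * (\<phi> \<bullet> (M *v u x)) - \<phi> \<bullet> g"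
    have "((\<lambda>s. \<phi> \<bullet> (M *v u1 s)) has_vector_derivative ?f x) (at x within {p..r})"
    proof (rule has_vector_derivative_ae_continuous[OF _ N _ _ x])
      show "continuous_on {p..r} ?f"
        unfolding M\<phi> using H2_derivs_continuous[OF u] sub
        by (intro continuous_intros c\<rho>) (auto elim: continuous_on_subset)
      show "\<phi> \<bullet> (M *v u2 s) = ?f s" if "s \<in> {p..r} - N" for s
        using R\<rho>[OF that] R[of s] by linarith
      show "\<phi> \<bullet> (M *v u1 s) = \<phi> \<bullet> (M *v u1 p) + integral {p..s} (\<lambda>s. \<phi> \<bullet> (M *v u2 s))"
        if "s \<in> {p..r}" for s
        unfolding M\<phi> by (rule H2_derivs_mode(1)[OF u pqr(1,4) that])
    qed
    then show "((\<lambda>s. \<phi> \<bullet> (M *v u1 s)) has_vector_derivative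
       \<rho> x - (\<alpha> + \<beta> * l) * (\<phi> \<bullet> (M *v u1 x)) - l * (\<phi> \<bullet> (M *v u x)) - \<phi> \<bullet> g) (at x within {p..r})"
      by (simp only: d_def)
  qed
qed

section \<open>Modal expansion and assembly of the modes\<close>

text \<open>Orthonormality says that the matrix with rows \<open>M *v \<phi> i\<close> times the
  matrix with columns \<open>\<phi> j\<close> is the identity. For square matrices the reversed
  product is the identity too, and that is the expansion.\<close>

lemma orthonormal_expansion:
  fixes \<phi> :: "'n \<Rightarrow> real ^ 'n" and M :: "real ^ 'n ^ 'n"
  assumes M: "transpose M = M" and orth: "\<And>i j. \<phi> i \<bullet> (M *v \<phi> j) = (if i = j then 1 else 0)"
  shows "x = (\<Sum>j\<in>UNIV. (\<phi> j \<bullet> (M *v x)) *\<^sub>R \<phi> j)"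
proof -
  define A where "A = (\<chi> i. M *v \<phi> i)"
  define B where "B = (\<chi> k j. \<phi> j $ k)"
  have M\<phi>: "(M *v \<phi> i) \<bullet> x = \<phi> i \<bullet> (M *v x)" for i x
    using inner_matrix_vector_transpose[of "\<phi> i" M x] by (simp add: M)
  have "(A ** B) $ i $ j = (M *v \<phi> i) \<bullet> \<phi> j" for i j
    by (simp add: matrix_matrix_mult_def A_def B_def inner_vec_def)
  then have "A ** B = mat 1" by (simp add: vec_eq_iff M\<phi> orth mat_def)
  then have "B ** A = mat 1" by (simp add: matrix_left_right_inverse)
  then have "x = B *v (A *v x)" by (simp add: matrix_vector_mul_assoc)
  also have "A *v x = (\<chi> i. A $ i \<bullet> x)" by (rule matrix_mult_dot)
  also have "\<dots> = (\<chi> i. \<phi> i \<bullet> (M *v x))" by (simp add: A_def M\<phi>)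
  also have "B *v \<dots> = (\<Sum>j\<in>UNIV. (\<phi> j \<bullet> (M *v x)) *\<^sub>R \<phi> j)"
    by (simp add: vec_eq_iff matrix_vector_mult_def B_def sum_component mult.commute)
  finally show ?thesis .
qed

text \<open>By orthonormality the coefficient of \<open>u\<close> along \<open>\<phi> i\<close> is
  \<open>\<phi> i \<bullet> (M *v u s)\<close>. Twice differentiability at an interior node is
  expressed as two-sided differentiability of \<open>vel\<close>.\<close>

theorem theorem1:
  fixes M K :: "real ^ 'n ^ 'n" and \<alpha> \<beta> cA cB :: real and g :: "real ^ 'n"
    and t :: "nat \<Rightarrow> real" and m :: nat
    and A B :: "nat \<Rightarrow> (real ^ 'n) list" and a b :: "nat \<Rightarrow> real list"
    and \<phi> :: "'n \<Rightarrow> real ^ 'n" and lam :: "'n \<Rightarrow> real"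
    and u :: "real \<Rightarrow> real ^ 'n"
  assumes M: "sym_posdef M"
    and K: "sym_possemidef K"
    and \<alpha>: "\<alpha> \<ge> 0" and \<beta>: "\<beta> \<ge> 0"
    and cA: "cA > 0" and cB: "cB > 0"
    and nodes: "\<And>k. k < m \<Longrightarrow> t k < t (Suc k)"
    and sizeA: "\<And>k. k \<le> m \<Longrightarrow> length (a k) = length (A k)"
    and sizeB: "\<And>k. k \<le> m \<Longrightarrow> length (b k) = length (B k)"
    and eig: "\<And>i. K *v \<phi> i = lam i *\<^sub>R (M *v \<phi> i)"
    and orth: "\<And>i j. \<phi> i \<bullet> (M *v \<phi> j) = (if i = j then 1 else 0)"
    and uH2: "H2 (t 0) (t m) u"
    and umin: "\<And>v. H2 (t 0) (t m) v \<Longrightarrow>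
        energyE M (\<alpha> *\<^sub>R M + \<beta> *\<^sub>R K) K g (t 0) (t m) u + energyC cA cB A a B b t m u
        \<le> energyE M (\<alpha> *\<^sub>R M + \<beta> *\<^sub>R K) K g (t 0) (t m) v + energyC cA cB A a B b t m v"
  shows
    "(\<forall>i. \<forall>k\<in>{1..m}.
        let \<omega> = (\<lambda>s. \<phi> i \<bullet> (M *v u s)); \<delta> = (\<alpha> + \<beta> * lam i) / 2; gi = \<phi> i \<bullet> g
        in smooth_on \<omega> {t (k - 1)<..<t k} \<and>
           (\<forall>s\<in>{t (k - 1)<..<t k}.
              (deriv ^^ 4) \<omega> s + 2 * (lam i - 2 * \<delta>\<^sup>2) * (deriv ^^ 2) \<omega> s
              + lam i * (lam i * \<omega> s + gi) = 0))
     \<and> (\<exists>u'. (\<forall>s\<in>{t 0..t m}. (u has_vector_derivative u' s) (at s within {t 0..t m}))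
            \<and> continuous_on {t 0..t m} u')
     \<and> (\<forall>k. 1 \<le> k \<and> k \<le> m - 1 \<and> B k = [] \<longrightarrow>
            vel (t 0) (t m) u differentiable (at (t k)))"
proof -
  obtain u1 u2 where u: "H2_derivs (t 0) (t m) u u1 u2" using uH2 H2_iff by blast
  have Ms: "transpose M = M" using M by (simp add: sym_posdef_def)
  have Ks: "transpose K = K" using K by (simp add: sym_possemidef_def)
  have less: "t i < t j" if "i < j" "j \<le> m" for i j
    using that
  proof (induction j)
    case (Suc j)
    then show ?case using nodes[of j] by (cases "i = j") auto
  qed simp
  have le: "t i \<le> t j" if "i \<le> j" "j \<le> m" for i j
    using less[of i j] that by (cases "i = j") auto
  have tk: "t k \<in> {t 0..t m}" if "k \<le> m" for k
    using le[of 0 k] le[of k m] that by simp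
  have orth1: "\<phi> i \<bullet> (M *v \<phi> i) = 1" for i using orth[of i i] by simp
  have M\<phi>: "\<phi> i \<bullet> (M *v x) = (M *v \<phi> i) \<bullet> x" for i x
    using inner_matrix_vector_transpose[of "\<phi> i" M x] by (simp add: Ms)
  have spline: "smooth_on (\<lambda>s. \<phi> i \<bullet> (M *v u s)) {t (k - 1)<..<t k}"
    "s \<in> {t (k - 1)<..<t k} \<Longrightarrow> (deriv ^^ 4) (\<lambda>s. \<phi> i \<bullet> (M *v u s)) s
       + (2 * lam i - (\<alpha> + \<beta> * lam i)\<^sup>2) * (deriv ^^ 2) (\<lambda>s. \<phi> i \<bullet> (M *v u s)) s
       + lam i * (lam i * (\<phi> i \<bullet> (M *v u s)) + \<phi> i \<bullet> g) = 0"
    if k: "k \<in> {1..m}" for i k s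
  proof -
    let ?p = "t (k - 1)" and ?r = "t k" and ?d = "\<alpha> + \<beta> * lam i"
    have pr: "?p \<le> ?r" "t 0 \<le> ?p" "?r \<le> t m" "t 0 < t m"
      using k le[of "k - 1" k] le[of 0 "k - 1"] le[of k m] less[of 0 m] by auto
    \<comment> \<open>Here \<open>q\<close> is taken to be the left endpoint: no node lies strictly
      inside, and the weight \<open>max 0 (?p - x)\<close> vanishes on the interval.\<close>
    have out: "t j \<le> ?p \<or> ?r \<le> t j \<or> (t j = ?p \<and> B j = [])" if "j \<le> m" for j
      using le[of j "k - 1"] le[of k j] that k by (cases "j < k") auto
    obtain c0 c1 c2 \<rho> where c\<rho>: "continuous_on {?p..?r} \<rho>"
      and \<rho>: "\<And>x. x \<in> {?p..?r} \<Longrightarrow> \<rho> x = c0 + c1 * (?r - x) + c2 * max 0 (?p - x)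
         + ?d * integral {?p..x} \<rho> - lam i * integral {?p..x} (\<lambda>y. integral {?p..y} \<rho>)"
      and w1: "\<And>x. x \<in> {?p..?r} \<Longrightarrow> ((\<lambda>s. \<phi> i \<bullet> (M *v u1 s)) has_vector_derivative
         \<rho> x - ?d * (\<phi> i \<bullet> (M *v u1 x)) - lam i * (\<phi> i \<bullet> (M *v u x)) - \<phi> i \<bullet> g) (at x within {?p..?r})"
      by (rule minimizer_mode_regularity[OF M Ks pr(4) tk eig[of i] orth1 u umin pr(2) order_refl pr(1) pr(3) out])
        (assumption | rule that)+
    \<comment> \<open>The formal derivative of the integral equation for \<open>\<rho>\<close>;
      differentiating once more yields the adjoint equation.\<close>
    define \<sigma> where "\<sigma> x = - c1 + ?d * \<rho> x - lam i * integral {?p..x} \<rho>" for x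
    have at: "at x within {?p..?r} = at x" "x \<in> {?p..?r}" if "x \<in> {?p<..<?r}" for x
      using that by (auto intro: at_within_Icc_at)
    have I1: "((\<lambda>x. integral {?p..x} \<rho>) has_field_derivative \<rho> x) (at x)" if "x \<in> {?p<..<?r}" for x
      using integral_has_real_derivative[OF c\<rho> at(2)[OF that]] at(1)[OF that] by simp
    have cI: "continuous_on {?p..?r} (\<lambda>x. integral {?p..x} \<rho>)"
      by (rule indefinite_integral_continuous_1[OF integrable_continuous_interval[OF c\<rho>]])
    have I2: "((\<lambda>x. integral {?p..x} (\<lambda>y. integral {?p..y} \<rho>)) has_field_derivative integral {?p..x} \<rho>) (at x)"
      if "x \<in> {?p<..<?r}" for x
      using integral_has_real_derivative[OF cI at(2)[OF that]] at(1)[OF that] by simp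
    have d\<rho>: "(\<rho> has_field_derivative \<sigma> x) (at x)" if x: "x \<in> {?p<..<?r}" for x
    proof (rule deriv_eq_on_open(1)[OF open_greaterThanLessThan _ _ x])
      show "\<rho> y = c0 + c1 * (?r - y) + ?d * integral {?p..y} \<rho>
          - lam i * integral {?p..y} (\<lambda>y. integral {?p..y} \<rho>)" if "y \<in> {?p<..<?r}" for y
        using \<rho>[of y] that by simp
      show "((\<lambda>y. c0 + c1 * (?r - y) + ?d * integral {?p..y} \<rho>
          - lam i * integral {?p..y} (\<lambda>y. integral {?p..y} \<rho>)) has_field_derivative \<sigma> y) (at y)"
        if "y \<in> {?p<..<?r}" for y
        by (rule derivative_eq_intros I1 I2 refl that | simp add: \<sigma>_def)+
    qed
    have d\<sigma>: "(\<sigma> has_field_derivative ?d * \<sigma> x - lam i * \<rho> x) (at x)" if "x \<in> {?p<..<?r}" for x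
      unfolding \<sigma>_def[abs_def]
      by (rule derivative_eq_intros d\<rho> I1 refl that | simp add: \<sigma>_def)+
    have dw: "((\<lambda>s. \<phi> i \<bullet> (M *v u s)) has_field_derivative \<phi> i \<bullet> (M *v u1 x)) (at x)"
      if "x \<in> {?p<..<?r}" for x
      using H2_derivs_mode(2)[OF u pr(2,3) at(2)[OF that], of "M *v \<phi> i"] at(1)[OF that]
      by (simp add: M\<phi> has_real_derivative_iff_has_vector_derivative)
    have dw1: "((\<lambda>s. \<phi> i \<bullet> (M *v u1 s)) has_field_derivative
         \<rho> x - ?d * (\<phi> i \<bullet> (M *v u1 x)) - lam i * (\<phi> i \<bullet> (M *v u x)) - \<phi> i \<bullet> g) (at x)"
      if "x \<in> {?p<..<?r}" for x
      using w1[OF at(2)[OF that]] at(1)[OF that] by (simp add: has_real_derivative_iff_has_vector_derivative)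
    note eq = wiggly_spline_equation[OF open_greaterThanLessThan dw dw1 d\<rho> d\<sigma>]
    show "smooth_on (\<lambda>s. \<phi> i \<bullet> (M *v u s)) {?p<..<?r}" by (rule eq(1))
    show "s \<in> {?p<..<?r} \<Longrightarrow> (deriv ^^ 4) (\<lambda>s. \<phi> i \<bullet> (M *v u s)) s
       + (2 * lam i - ?d\<^sup>2) * (deriv ^^ 2) (\<lambda>s. \<phi> i \<bullet> (M *v u s)) s
       + lam i * (lam i * (\<phi> i \<bullet> (M *v u s)) + \<phi> i \<bullet> g) = 0" by (rule eq(2))
  qed
  have coeff: "2 * (l - 2 * (d / 2)\<^sup>2) = 2 * l - d\<^sup>2" for l d :: real
    by (simp add: power_divide)
  have knot: "vel (t 0) (t m) u differentiable (at (t k))"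
    if k: "1 \<le> k" "k \<le> m - 1" and Bk: "B k = []" for k
  proof -
    \<comment> \<open>Both neighbouring intervals are treated together, with the node as
      \<open>q\<close>; the bounds on \<open>k\<close> ensure that both neighbours are
      nodes.\<close>
    let ?p = "t (k - 1)" and ?q = "t k" and ?r = "t (k + 1)"
    have pqr: "?p < ?q" "?q < ?r" "t 0 \<le> ?p" "?r \<le> t m" "t 0 < t m"
      using k less[of "k - 1" k] less[of k "k + 1"] le[of 0 "k - 1"] le[of "k + 1" m] less[of 0 m] by auto
    have out: "t j \<le> ?p \<or> ?r \<le> t j \<or> (t j = ?q \<and> B j = [])" if "j \<le> m" for j
    proof -
      consider "j \<le> k - 1" | "j = k" | "k + 1 \<le> j" by linarith
      then show ?thesis using le[of j "k - 1"] le[of "k + 1" j] that k Bk by cases auto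
    qed
    have "\<exists>D. ((\<lambda>s. \<phi> i \<bullet> (M *v u1 s)) has_vector_derivative D) (at ?q)" for i
    proof -
      obtain \<rho> where "\<And>x. x \<in> {?p..?r} \<Longrightarrow> ((\<lambda>s. \<phi> i \<bullet> (M *v u1 s)) has_vector_derivative
         \<rho> x - (\<alpha> + \<beta> * lam i) * (\<phi> i \<bullet> (M *v u1 x)) - lam i * (\<phi> i \<bullet> (M *v u x)) - \<phi> i \<bullet> g) (at x within {?p..?r})"
        by (rule minimizer_mode_regularity[OF M Ks pqr(5) tk eig[of i] orth1 u umin pqr(3)
              less_imp_le[OF pqr(1)] less_imp_le[OF pqr(2)] pqr(4) out]) (assumption | rule that)+
      \<comment> \<open>The node is interior to \<open>{?p..?r}\<close>, so the derivative within
        the interval is a two-sided one.\<close>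
      from this[of ?q] show ?thesis
        using at_within_Icc_at[OF pqr(1,2)] pqr by auto
    qed
    then obtain D where D: "\<And>i. ((\<lambda>s. \<phi> i \<bullet> (M *v u1 s)) has_vector_derivative D i) (at ?q)"
      by metis
    have "((\<lambda>s. \<Sum>j\<in>UNIV. (\<phi> j \<bullet> (M *v u1 s)) *\<^sub>R \<phi> j) has_vector_derivative (\<Sum>j\<in>UNIV. D j *\<^sub>R \<phi> j)) (at ?q)"
      by (intro has_vector_derivative_sum bounded_linear.has_vector_derivative[OF bounded_linear_scaleR_left] D)
    then have "(u1 has_vector_derivative (\<Sum>j\<in>UNIV. D j *\<^sub>R \<phi> j)) (at ?q)"
      unfolding orthonormal_expansion[OF Ms orth, symmetric] .
    then have "(vel (t 0) (t m) u has_vector_derivative (\<Sum>j\<in>UNIV. D j *\<^sub>R \<phi> j)) (at ?q)"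
    proof (rule has_vector_derivative_transform_within_open)
      show "open {?p<..<?r}" "?q \<in> {?p<..<?r}" using pqr by auto
      show "u1 x = vel (t 0) (t m) u x" if "x \<in> {?p<..<?r}" for x
        using H2_derivs_vel[OF u pqr(5), of x] pqr that by simp
    qed
    then show ?thesis by (rule differentiableI_vector)
  qed
  have C1: "\<exists>u'. (\<forall>s\<in>{t 0..t m}. (u has_vector_derivative u' s) (at s within {t 0..t m}))
            \<and> continuous_on {t 0..t m} u'"
    using u H2_derivs_continuous(2)[OF u] unfolding H2_derivs_def by blast
  show ?thesis
    unfolding Let_def coeff using spline knot C1 by blast
qed

end
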